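(* The pair of permutation statistics $(\mathrm{exc},\mathrm{sden})$ is Euler--Mahonian; that is, for every positive integer $n$, the pairs $(\mathrm{exc},\mathrm{sden})$ and $(\mathrm{des},\mathrm{maj})$ are equidistributed over $\mathfrak{S}_n$: for all integers $a,b$, $$|\{\sigma\in\mathfrak{S}_n:\mathrm{exc}(\sigma)=a,\ \mathrm{sden}(\sigma)=b\}|=|\{\sigma\in\mathfrak{S}_n:\mathrm{des}(\sigma)=a,\ \mathrm{maj}(\sigma)=b\}|.$$
   Context: $\mathfrak{S}_n$ is the set of permutations $\sigma=\sigma_1\sigma_2\ldots\sigma_n$ of $\{1,2,\ldots,n\}$, in one-line notation. A descent of $\sigma$ is a position $i$, $1\leqslant i\leqslant n-1$, with $\sigma_i>\sigma_{i+1}$; $\mathrm{des}(\sigma)$ is the number of descents and $\mathrm{maj}(\sigma)$ is the sum of the descents of $\sigma$. An excedance (excedance position) of $\sigma$ is a position $i$ with $\sigma_i>i$; $\mathrm{Exc}(\sigma)$ is the set of excedances and $\mathrm{exc}(\sigma)=|\mathrm{Exc}(\sigma)|$. If $i$ is an excedance, $\sigma_i$ is called an excedance letter; the other letters are non-excedance letters. $\mathrm{EXCL}(\sigma)$ is the subsequence of $\sigma$ consisting of the excedance letters, and $\mathrm{NEXCL}(\sigma)$ is the subsequence of $\sigma$ consisting of the non-excedance letters. For a sequence of distinct integers, $\mathrm{inv}$ is the number of pairs of positions $i<j$ such that the $i$-th entry is larger than the $j$-th entry. Sorting index: let $\tau=\tau_1\tau_2\ldots\tau_m$ be a permutation of a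 finite set $A=\{a_1<a_2<\cdots<a_m\}$ of positive integers (written as a sequence). Sort $\tau$ into $a_1a_2\ldots a_m$ by Straight Selection Sort: for $r=m,m-1,\ldots,1$ in this order, if $a_r$ currently stands at position $i$, exchange the entries at positions $i$ and $r$ (do nothing if $i=r$); this step contributes $r-i$. The sorting index $\mathrm{sor}(\tau)$ is the sum of these contributions. (For the empty sequence, $\mathrm{inv}$ and $\mathrm{sor}$ are $0$.) The sorting-Denert statistic is $$\mathrm{sden}(\sigma)=\sum_{i\in\mathrm{Exc}(\sigma)}i+\mathrm{inv}(\mathrm{EXCL}(\sigma))+\mathrm{sor}(\mathrm{NEXCL}(\sigma)).$$ *)

theory Defs
  imports "HOL-Combinatorics.Multiset_Permutations"
begin

text \<open>
  A permutation \<open>\<sigma>\<close> of \<open>{1..n}\<close> is represented by its one-line notation, i.e. by the list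
  \<open>[\<sigma>\<^sub>1, \<dots>, \<sigma>\<^sub>n] \<in> permutations_of_set {1..n}\<close>. All positions are 1-based, as in
  \<open>\<sigma>\<^sub>1 \<dots> \<sigma>\<^sub>n\<close>, whereas \<open>(!)\<close> is 0-based; \<open>entry\<close> bridges the two.
\<close>

abbreviation perms :: "nat \<Rightarrow> nat list set" where
  "perms n \<equiv> permutations_of_set {1..n}"

definition entry :: "'a list \<Rightarrow> nat \<Rightarrow> 'a" where
  "entry w i = w ! (i - 1)"

definition Des :: "nat list \<Rightarrow> nat set" where
  "Des w = {i. 1 \<le> i \<and> i < length w \<and> entry w i > entry w (i + 1)}"

definition des :: "nat list \<Rightarrow> nat" where
  "des w = card (Des w)"

definition maj :: "nat list \<Rightarrow> nat" where
  "maj w = \<Sum>(Des w)"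

definition Exc :: "nat list \<Rightarrow> nat set" where
  "Exc w = {i. 1 \<le> i \<and> i \<le> length w \<and> entry w i > i}"

definition exc :: "nat list \<Rightarrow> nat" where
  "exc w = card (Exc w)"

definition EXCL :: "nat list \<Rightarrow> nat list" where
  "EXCL w = map (entry w) (filter (\<lambda>i. i \<in> Exc w) [1..<length w + 1])"

definition NEXCL :: "nat list \<Rightarrow> nat list" where
  "NEXCL w = map (entry w) (filter (\<lambda>i. i \<notin> Exc w) [1..<length w + 1])"

definition inversions :: "nat list \<Rightarrow> nat" where
  "inversions w =
     card {(i, j). 1 \<le> i \<and> i < j \<and> j \<le> length w \<and> entry w i > entry w j}"

text \<open>\<open>position\<close> is meaningful for a letter that occurs exactly once in the list.\<close>

definition position :: "'a list \<Rightarrow> 'a \<Rightarrow> nat" where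
  "position w x = (THE i. 1 \<le> i \<and> i \<le> length w \<and> entry w i = x)"

definition exchange :: "'a list \<Rightarrow> nat \<Rightarrow> nat \<Rightarrow> 'a list" where
  "exchange w i j = w[i - 1 := entry w j, j - 1 := entry w i]"

text \<open>
  \<open>selection_cost a r w\<close> is the total contribution of the steps \<open>r, r - 1, \<dots>, 1\<close> of Straight
  Selection Sort, started in the state \<open>w\<close>, where \<open>a\<close> is the increasing list of all letters.
  When step \<open>r\<close> of the sort is reached, the letters \<open>a\<^sub>s\<close> with \<open>s > r\<close> already occupy
  the positions \<open>s\<close>, so \<open>a\<^sub>r\<close> stands at a position \<open>i \<le> r\<close> and the subtraction on \<open>nat\<close>
  does not truncate. Exchanging a position with itself leaves the list unchanged.
\<close>

fun selection_cost :: "nat list \<Rightarrow> nat \<Rightarrow> nat list \<Rightarrow> nat" where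
  "selection_cost a 0 w = 0"
| "selection_cost a (Suc r) w =
     (let i = position w (entry a (Suc r))
      in (Suc r - i) + selection_cost a r (exchange w i (Suc r)))"

definition sor :: "nat list \<Rightarrow> nat" where
  "sor w = selection_cost (sorted_list_of_set (set w)) (length w) w"

definition sden :: "nat list \<Rightarrow> nat" where
  "sden w = \<Sum>(Exc w) + inversions (EXCL w) + sor (NEXCL w)"

end

theory Submission
  imports Defs "HOL-Computational_Algebra.Polynomial"
begin

text \<open>
  For fixed \<open>k\<close>, let \<open>A\<^sub>n(k)\<close> be the sum of \<open>q\<^bsup>maj w\<^esup>\<close> over the permutations \<open>w\<close> of
  \<open>{1..n}\<close> with \<open>k\<close> descents. Inserting the letter \<open>n + 1\<close> into all slots of \<open>w\<close> gives Carlitz's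
  recurrence \<open>A\<^sub>n\<^sub>+\<^sub>1(k) = [k + 1] A\<^sub>n(k) + q\<^sup>k [n + 1 - k] A\<^sub>n(k - 1)\<close>, where \<open>[i]\<close> is the \<open>q\<close>-number
  \<open>1 + q + \<dots> + q\<^bsup>i-1\<^esup>\<close>. The theorem holds because \<open>(exc, sden)\<close> leads to the same recurrence.

  Fix the set \<open>I\<close> of excedance positions and the set \<open>J\<close> of excedance letters. The sequence of
  excedance letters is then any arrangement of \<open>J\<close> that lies strictly above the sorted list of \<open>I\<close>,
  and independently of it the sequence of the other letters is any arrangement of the complement
  of \<open>J\<close> that lies weakly below the complement of \<open>I\<close>. So the sum of \<open>q\<^bsup>sden\<^esup>\<close> splits into
  \<open>q\<^bsup>\<Sum>I\<^esup>\<close>, a sum of \<open>q\<^bsup>inv\<^esup>\<close> and a sum of \<open>q\<^bsup>sor\<^esup>\<close>. Both sums are products of \<open>q\<close>-numbers: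
  for \<open>inv\<close> one inserts the smallest letter into a shorter word, and for \<open>sor\<close> one undoes the first
  exchange of the sort, which concerns the largest letter; each admissible place for the letter
  contributes a different exponent, and these exponents are \<open>0, 1, 2, \<dots>\<close>. The factor of the letter
  \<open>x\<close> depends only on the height \<open>|I \<inter> [1, x)| - |J \<inter> [1, x)|\<close>. Hence the pairs \<open>(I, J)\<close>
  become weighted lattice walks, which go up at the elements of \<open>I\<close> and down at those of \<open>J\<close>, and
  \<open>exc_sden_gf_eq_walk_gf\<close> says that \<open>(exc, sden)\<close> is counted by the walks that end at height \<open>0\<close>.

  Let \<open>P\<^sub>n(k, h)\<close> be the weighted number of walks with \<open>k\<close> up-steps that end at height \<open>h\<close>. Its
  recurrence in \<open>n\<close> mixes neighbouring heights. It is closed up by the identity \<open>walk_gf_shift\<close>,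
  \<open>[h + 1] (P\<^sub>n(k, h) + P\<^sub>n(k, h + 1)) = [k + 1] P\<^sub>n(k, h) + q\<^sup>k [n + 1 - k] P\<^sub>n(k - 1, h)\<close>,
  which trades an operator acting on \<open>h\<close> for one acting on \<open>k\<close>. At \<open>h = 0\<close> the left side is
  \<open>P\<^sub>n\<^sub>+\<^sub>1(k, 0)\<close>, and the identity is Carlitz's recurrence.
\<close>

section \<open>Weighted lattice walks\<close>

text \<open>
  The \<open>q\<close>-number \<open>[i]\<close>. It vanishes for negative \<open>i\<close> too, so a walk that would pass below height \<open>0\<close>
  gets weight \<open>0\<close> and need not be excluded.
\<close>

definition qnum :: "'a::comm_semiring_1 \<Rightarrow> int \<Rightarrow> 'a" where
  "qnum q i = (\<Sum>l<nat i. q ^ l)"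

lemma qnum_nonpos [simp]: "i \<le> 0 \<Longrightarrow> qnum q i = 0"
  by (simp add: qnum_def)

lemma qnum_plus_1_left: "0 \<le> i \<Longrightarrow> qnum q (i + 1) = 1 + q * qnum q i"
  by (simp add: qnum_def nat_add_distrib sum.lessThan_Suc_shift sum_distrib_left del: sum.lessThan_Suc)

lemma qnum_plus_1_right: "0 \<le> i \<Longrightarrow> qnum q (i + 1) = qnum q i + q ^ nat i"
  by (simp add: qnum_def nat_add_distrib)

text \<open>
  The height of the walk just before step \<open>x\<close>, when step \<open>i\<close> goes up for \<open>i \<in> I\<close> and down for
  \<open>i \<in> J\<close> (and stays level if \<open>i\<close> is in both).
\<close>

definition height :: "nat set \<Rightarrow> nat set \<Rightarrow> nat \<Rightarrow> int" where
  "height I J x = int (card {i \<in> I. i < x}) - int (card {j \<in> J. j < x})"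

text \<open>
  With \<open>I\<close> as excedance positions and \<open>J\<close> as excedance letters, each factor is a generating function for
  the positions that a letter can take. Place the letters of \<open>J\<close> in increasing order: \<open>height I J x\<close>
  positions of \<open>I\<close> below \<open>x\<close> are free when \<open>x\<close> is reached. Place the other letters in decreasing
  order: if \<open>|I| = |J|\<close>, then \<open>height I J x + 1\<close> positions outside \<open>I\<close> and not below \<open>x\<close> are free.
\<close>

definition weight :: "'a::comm_semiring_1 \<Rightarrow> nat \<Rightarrow> nat set \<Rightarrow> nat set \<Rightarrow> 'a" where
  "weight q n I J = q ^ \<Sum>I * (\<Prod>x\<in>J. qnum q (height I J x))
     * (\<Prod>x\<in>{1..n} - J. qnum q (height I J x + 1))"

definition walk_gf :: "'a::comm_semiring_1 \<Rightarrow> nat \<Rightarrow> int \<Rightarrow> int \<Rightarrow> 'a" where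
  "walk_gf q n k h = (\<Sum>I\<in>Pow {1..n}. \<Sum>J\<in>Pow {1..n}.
     if int (card I) = k \<and> int (card I) - int (card J) = h then weight q n I J else 0)"

lemma height_insert_left:
  "x \<le> y \<Longrightarrow> height (insert y I) J x = height I J x"
proof -
  assume "x \<le> y"
  then have "{i \<in> insert y I. i < x} = {i \<in> I. i < x}" by auto
  then show ?thesis by (simp add: height_def)
qed

lemma height_insert_right:
  "x \<le> y \<Longrightarrow> height I (insert y J) x = height I J x"
proof -
  assume "x \<le> y"
  then have "{i \<in> insert y J. i < x} = {i \<in> J. i < x}" by auto
  then show ?thesis by (simp add: height_def)
qed

lemma height_above:
  assumes "I \<subseteq> {1..n}" "J \<subseteq> {1..n}"
  shows "height I J (Suc n) = int (card I) - int (card J)"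
proof -
  have "{i \<in> I. i < Suc n} = I" "{j \<in> J. j < Suc n} = J" using assms by auto
  then show ?thesis by (simp add: height_def)
qed

text \<open>
  The element \<open>n + 1\<close> does not affect the heights before earlier steps, so each of its four possible
  memberships multiplies the weight by the factor of the last step alone.
\<close>

lemma weight_Suc:
  fixes q :: "'a::comm_semiring_1"
  assumes I: "I \<subseteq> {1..n}" and J: "J \<subseteq> {1..n}"
  defines "h \<equiv> int (card I) - int (card J)"
  shows "weight q (Suc n) I J = weight q n I J * qnum q (h + 1)"
    and "weight q (Suc n) I (insert (Suc n) J) = weight q n I J * qnum q h"
    and "weight q (Suc n) (insert (Suc n) I) J = q ^ Suc n * weight q n I J * qnum q (h + 1)"
    and "weight q (Suc n) (insert (Suc n) I) (insert (Suc n) J) = q ^ Suc n * weight q n I J * qnum q h"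
proof -
  have fin: "finite I" "finite J" and nI: "Suc n \<notin> I" and nJ: "Suc n \<notin> J"
    using I J by (auto intro: finite_subset)
  have 1: "{1..Suc n} - J = insert (Suc n) ({1..n} - J)" using nJ by auto
  have 2: "{1..Suc n} - insert (Suc n) J = {1..n} - J" by auto
  have top: "height I J (Suc n) = h" unfolding h_def by (rule height_above[OF I J])
  have sI: "\<Sum>(insert (Suc n) I) = Suc n + \<Sum>I" using fin nI by simp
  have le: "x \<le> Suc n" if "x \<in> J \<or> x \<in> {1..n} - J" for x using that J by auto
  have hl: "height (insert (Suc n) I) J x = height I J x"
    and hr: "height I (insert (Suc n) J) x = height I J x"
    and hlr: "height (insert (Suc n) I) (insert (Suc n) J) x = height I J x"
    if "x \<le> Suc n" for x J
    using that by (simp_all add: height_insert_left height_insert_right)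
  have p1: "(\<Prod>x\<in>J. qnum q (height (insert (Suc n) I) J x)) = (\<Prod>x\<in>J. qnum q (height I J x))"
           "(\<Prod>x\<in>J. qnum q (height I (insert (Suc n) J) x)) = (\<Prod>x\<in>J. qnum q (height I J x))"
           "(\<Prod>x\<in>J. qnum q (height (insert (Suc n) I) (insert (Suc n) J) x)) = (\<Prod>x\<in>J. qnum q (height I J x))"
    by (intro prod.cong refl; use le in \<open>simp add: hl hr hlr\<close>)+
  have p2: "(\<Prod>x\<in>{1..n}-J. qnum q (height (insert (Suc n) I) J x + 1)) = (\<Prod>x\<in>{1..n}-J. qnum q (height I J x + 1))"
           "(\<Prod>x\<in>{1..n}-J. qnum q (height I (insert (Suc n) J) x + 1)) = (\<Prod>x\<in>{1..n}-J. qnum q (height I J x + 1))"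
           "(\<Prod>x\<in>{1..n}-J. qnum q (height (insert (Suc n) I) (insert (Suc n) J) x + 1)) = (\<Prod>x\<in>{1..n}-J. qnum q (height I J x + 1))"
    by (intro prod.cong refl; use le in \<open>simp add: hl hr hlr\<close>)+
  show "weight q (Suc n) I J = weight q n I J * qnum q (h + 1)"
    unfolding weight_def 1 by (simp add: top mult_ac)
  show "weight q (Suc n) I (insert (Suc n) J) = weight q n I J * qnum q h"
    unfolding weight_def 2 p2 using fin nJ by (simp add: p1 hr top mult_ac)
  show "weight q (Suc n) (insert (Suc n) I) J = q ^ Suc n * weight q n I J * qnum q (h + 1)"
    unfolding weight_def 1 sI p1 by (simp add: p2 hl top mult_ac power_add)
  show "weight q (Suc n) (insert (Suc n) I) (insert (Suc n) J) = q ^ Suc n * weight q n I J * qnum q h"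
    unfolding weight_def 2 sI p2 using fin nJ by (simp add: p1 hlr top mult_ac power_add)
qed

lemma sum_Pow_insert:
  fixes f :: "'b set \<Rightarrow> 'a::comm_monoid_add"
  assumes "finite A" "x \<notin> A"
  shows "(\<Sum>B\<in>Pow (insert x A). f B) = (\<Sum>B\<in>Pow A. f B + f (insert x B))"
proof -
  have "(\<Sum>B\<in>Pow (insert x A). f B) = sum f (Pow A) + sum f (insert x ` Pow A)"
    unfolding Pow_insert by (rule sum.union_disjoint) (use assms in auto)
  also have "sum f (insert x ` Pow A) = (\<Sum>B\<in>Pow A. f (insert x B))"
    by (subst sum.reindex) (use assms in \<open>auto simp: inj_on_def\<close>)
  finally show ?thesis by (simp add: sum.distrib)
qed

lemma walk_gf_0: "walk_gf q 0 k h = (if k = 0 \<and> h = 0 then 1 else 0)"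
  by (auto simp: walk_gf_def weight_def)

lemma walk_gf_Suc:
  fixes q :: "'a::comm_semiring_1"
  shows "walk_gf q (Suc n) k h =
    qnum q (h + 1) * (walk_gf q n k h + walk_gf q n k (h + 1)) +
    q ^ Suc n * (qnum q h * (walk_gf q n (k - 1) (h - 1) + walk_gf q n (k - 1) h))"
proof -
  define g where "g k h I J =
    (if int (card I) = k \<and> int (card I) - int (card J) = h then weight q n I J else 0)" for k h I J
  have walk_g: "walk_gf q n k h = (\<Sum>I\<in>Pow {1..n}. \<Sum>J\<in>Pow {1..n}. g k h I J)" for k h
    by (simp add: walk_gf_def g_def)
  have ins: "{1..Suc n} = insert (Suc n) {1..n}" by auto
  have sP: "(\<Sum>B\<in>Pow (insert (Suc n) {1..n}). f B) = (\<Sum>B\<in>Pow {1..n}. f B + f (insert (Suc n) B))"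
    for f :: "nat set \<Rightarrow> 'a" by (rule sum_Pow_insert) auto
  have "walk_gf q (Suc n) k h = (\<Sum>I\<in>Pow {1..n}. \<Sum>J\<in>Pow {1..n}.
      qnum q (h + 1) * (g k h I J + g k (h + 1) I J) +
      q ^ Suc n * (qnum q h * (g (k - 1) (h - 1) I J + g (k - 1) h I J)))"
    unfolding walk_gf_def ins sP sum.distrib [symmetric]
    apply (intro sum.cong refl)
    subgoal premises p for I J
    proof -
      have I: "I \<subseteq> {1..n}" and J: "J \<subseteq> {1..n}" using p by auto
      have fin: "finite I" "finite J" and nI: "Suc n \<notin> I" and nJ: "Suc n \<notin> J"
        using I J by (auto intro: finite_subset)
      have c: "card (insert (Suc n) I) = Suc (card I)" "card (insert (Suc n) J) = Suc (card J)"
        using fin nI nJ by auto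
      show ?thesis
        unfolding g_def c weight_Suc[OF I J]
        by (auto simp: algebra_simps)
    qed
    done
  also have "\<dots> = qnum q (h + 1) * (walk_gf q n k h + walk_gf q n k (h + 1)) +
    q ^ Suc n * (qnum q h * (walk_gf q n (k - 1) (h - 1) + walk_gf q n (k - 1) h))"
    by (simp only: walk_g sum.distrib sum_distrib_left[symmetric])
  finally show ?thesis .
qed

lemma walk_gf_eq_0:
  assumes "k < 0 \<or> k > int n \<or> h < 0"
  shows "walk_gf q n k h = 0"
  using assms
proof (induction n arbitrary: k h)
  case 0
  then show ?case by (auto simp: walk_gf_0)
next
  case (Suc n)
  have "walk_gf q n k h = 0 " "walk_gf q n k (h+1) = 0 \<or> h < 0" "walk_gf q n (k - 1) h = 0"
    "walk_gf q n (k - 1) (h-1) = 0"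
    using Suc.prems by (auto intro!: Suc.IH)
  then show ?case unfolding walk_gf_Suc by auto
qed

text \<open>
  Write \<open>D\<close> for the operator on the left, which acts on \<open>h\<close>, and \<open>N\<^sub>n\<close> for the one on the right,
  which acts on \<open>k\<close>; the claim is \<open>D P\<^sub>n = N\<^sub>n P\<^sub>n\<close> for \<open>P\<^sub>n = walk_gf q n\<close>. Let \<open>f = D P\<^sub>m\<close>. As \<open>D\<close>
  and \<open>N\<^sub>m\<close> commute, the induction hypothesis \<open>f = N\<^sub>m P\<^sub>m\<close> gives \<open>D f = N\<^sub>m f\<close> as well. The recurrence
  expresses \<open>P\<^sub>m\<^sub>+\<^sub>1\<close> by \<open>f\<close>, and both \<open>D P\<^sub>m\<^sub>+\<^sub>1\<close> and \<open>N\<^sub>m\<^sub>+\<^sub>1 P\<^sub>m\<^sub>+\<^sub>1\<close> expand to the same combination of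
  values of \<open>f\<close>.
\<close>

lemma walk_gf_shift:
  fixes q :: "'a::comm_semiring_1"
  shows "qnum q (h + 1) * (walk_gf q n k h + walk_gf q n k (h + 1)) =
    qnum q (k + 1) * walk_gf q n k h + q ^ nat k * qnum q (int n + 1 - k) * walk_gf q n (k - 1) h"
proof (induction n arbitrary: k h)
  case 0
  show ?case by (auto simp: walk_gf_0 qnum_def)
next
  case (Suc m)
  define f where "f k h = qnum q (h + 1) * (walk_gf q m k h + walk_gf q m k (h + 1))" for k h
  have W: "walk_gf q (Suc m) k h = f k h + q ^ Suc m * f (k - 1) (h - 1)" for k h
    unfolding walk_gf_Suc f_def by simp
  have f_IH: "f k h = qnum q (k + 1) * walk_gf q m k h + q ^ nat k * qnum q (int m + 1 - k) * walk_gf q m (k - 1) h" for k h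
    unfolding f_def by (rule Suc.IH)
  have f0: "f k h = 0" if "k < 0 \<or> k > int m \<or> h < 0" for k h
    using that by (auto simp: f_def walk_gf_eq_0)
  have ff: "qnum q (h + 1) * (f k h + f k (h + 1)) =
      qnum q (k + 1) * f k h + q ^ nat k * qnum q (int m + 1 - k) * f (k - 1) h" for k h
  proof -
    have "qnum q (h + 1) * (f k h + f k (h + 1)) = 
      qnum q (k + 1) * (qnum q (h + 1) * (walk_gf q m k h + walk_gf q m k (h + 1)))
      + q ^ nat k * qnum q (int m + 1 - k) * (qnum q (h + 1) * (walk_gf q m (k - 1) h + walk_gf q m (k - 1) (h + 1)))"
      unfolding f_IH by (simp add: algebra_simps)
    then show ?thesis by (simp add: f_def)
  qed
  show ?case
  proof (cases "h < 0 \<or> k < 0")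
    case True
    then have "walk_gf q (Suc m) k h = 0" "walk_gf q (Suc m) (k - 1) h = 0" 
       "qnum q (h + 1) = 0 \<or> walk_gf q (Suc m) k (h+1) = 0"
      by (auto intro: walk_gf_eq_0)
    then show ?thesis by auto
  next
    case False
    then have h: "0 \<le> h" and k: "0 \<le> k" by auto
    \<comment> \<open>Beyond \<open>k = m + 1\<close> the coefficients differ, but there \<open>f (k - 1) h\<close> vanishes.\<close>
    have a: "(q ^ nat k * qnum q (int m + 1 - k) + q ^ Suc m) * f (k - 1) h
        = q ^ nat k * qnum q (int (Suc m) + 1 - k) * f (k - 1) h"
    proof (cases "k \<le> int m + 1")
      case True
      have "qnum q (int (Suc m) + 1 - k) = qnum q (int m + 1 - k) + q ^ nat (int m + 1 - k)"
        using qnum_plus_1_right[of "int m + 1 - k" q] True by (simp add: algebra_simps)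
      moreover have "q ^ Suc m = q ^ nat k * q ^ nat (int m + 1 - k)"
        using True k by (simp flip: power_add nat_add_distrib) (simp add: nat_add_distrib)
      ultimately show ?thesis by (simp add: algebra_simps)
    next
      case False
      then show ?thesis by (simp add: f0)
    qed
    \<comment> \<open>The factor \<open>[h + 1] = 1 + q [h]\<close> is split so that \<open>ff\<close> applies at height \<open>h - 1\<close>.\<close>
    have b: "qnum q (h + 1) * (f (k - 1) (h - 1) + f (k - 1) h) =
        f (k - 1) (h - 1) + f (k - 1) h + q * (qnum q k * f (k - 1) (h - 1) +
          q ^ nat (k - 1) * qnum q (int m + 2 - k) * f (k - 2) (h - 1))"
    proof -
      have "qnum q (h + 1) * y = y + q * (qnum q h * y)" for y
        by (simp only: qnum_plus_1_left[OF h]) (simp add: algebra_simps)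
      moreover have "qnum q h * (f (k - 1) (h - 1) + f (k - 1) h) =
          qnum q k * f (k - 1) (h - 1) + q ^ nat (k - 1) * qnum q (int m + 2 - k) * f (k - 2) (h - 1)"
        using ff[of "h - 1" "k - 1"] by (simp add: algebra_simps)
      ultimately show ?thesis by (simp only:)
    qed
    have c: "f (k - 1) (h - 1) + q * (qnum q k * f (k - 1) (h - 1)) = qnum q (k + 1) * f (k - 1) (h - 1)"
      by (simp only: qnum_plus_1_left[OF k]) (simp add: algebra_simps)
    have d: "q * (q ^ nat (k - 1) * (qnum q (int m + 2 - k) * f (k - 2) (h - 1)))
        = q ^ nat k * (qnum q (int m + 2 - k) * f (k - 2) (h - 1))"
    proof (cases "k = 0")
      case True then show ?thesis by (simp add: f0)
    next
      case False
      then have "nat k = Suc (nat (k - 1))" using k by simp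
      then show ?thesis by (simp add: algebra_simps)
    qed
    have "qnum q (h + 1) * (walk_gf q (Suc m) k h + walk_gf q (Suc m) k (h + 1)) =
        qnum q (h + 1) * (f k h + f k (h + 1))
        + q ^ Suc m * (qnum q (h + 1) * (f (k - 1) (h - 1) + f (k - 1) h))"
      unfolding W by (simp add: algebra_simps)
    also have "\<dots> = qnum q (k + 1) * f k h + q ^ nat k * qnum q (int m + 1 - k) * f (k - 1) h
        + q ^ Suc m * f (k - 1) h
        + q ^ Suc m * (f (k - 1) (h - 1) + q * (qnum q k * f (k - 1) (h - 1)))
        + q ^ Suc m * (q * (q ^ nat (k - 1) * (qnum q (int m + 2 - k) * f (k - 2) (h - 1))))"
      unfolding b ff by (simp add: algebra_simps)
    also have "\<dots> = qnum q (k + 1) * f k h 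
        + (q ^ nat k * qnum q (int m + 1 - k) + q ^ Suc m) * f (k - 1) h
        + q ^ Suc m * (qnum q (k + 1) * f (k - 1) (h - 1))
        + q ^ Suc m * (q ^ nat k * (qnum q (int m + 2 - k) * f (k - 2) (h - 1)))"
      unfolding c d by (simp add: algebra_simps)
    also have "\<dots> = qnum q (k + 1) * walk_gf q (Suc m) k h +
        q ^ nat k * qnum q (int (Suc m) + 1 - k) * walk_gf q (Suc m) (k - 1) h"
      unfolding a W by (simp add: algebra_simps)
    finally show ?thesis .
  qed
qed

lemma walk_gf_height_0_Suc:
  fixes q :: "'a::comm_semiring_1"
  shows "walk_gf q (Suc n) k 0 =
    qnum q (k + 1) * walk_gf q n k 0 + q ^ nat k * qnum q (int n + 1 - k) * walk_gf q n (k - 1) 0"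
  using walk_gf_Suc[of q n k 0] walk_gf_shift[of q 0 n k] by simp

section \<open>Inserting a letter into a permutation\<close>

text \<open>
  Any way \<open>F\<close> of adding a new letter \<open>x\<close> at a prescribed place \<open>p\<close> that loses no information reaches
  every larger permutation exactly once: \<open>p\<close> can be read off as the place of \<open>x\<close>, so \<open>F\<close> is injective,
  and the numbers \<open>(m + 1) m!\<close> and \<open>(m + 1)!\<close> agree. Two choices of \<open>F\<close> are used below, insertion
  and exchange.
\<close>

lemma sum_permutations_of_set_insert:
  fixes f :: "'b list \<Rightarrow> 'a::comm_monoid_add"
  assumes A: "finite A" "x \<notin> A"
    and mem: "\<And>p w. p \<le> card A \<Longrightarrow> w \<in> permutations_of_set A \<Longrightarrow> F p w \<in> permutations_of_set (insert x A)"
    and nth: "\<And>p w. p \<le> card A \<Longrightarrow> w \<in> permutations_of_set A \<Longrightarrow> F p w ! p = x"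
    and inv: "\<And>p w. p \<le> card A \<Longrightarrow> w \<in> permutations_of_set A \<Longrightarrow> G p (F p w) = w"
  shows "(\<Sum>u\<in>permutations_of_set (insert x A). f u) =
    (\<Sum>w\<in>permutations_of_set A. \<Sum>p\<le>card A. f (F p w))"
proof -
  let ?S = "permutations_of_set A \<times> {..card A}"
  let ?F = "\<lambda>(w, p). F p w"
  have inj: "inj_on ?F ?S"
  proof (rule inj_onI, clarsimp, rule conjI)
    fix w p w' p'
    assume w: "w \<in> permutations_of_set A" "p \<le> card A" "w' \<in> permutations_of_set A" "p' \<le> card A"
      and eq: "F p w = F p' w'"
    have "distinct (F p w)" "length (F p w) = Suc (card A)"
      using mem[OF w(2,1)] A by (auto dest: permutations_of_setD length_finite_permutations_of_set)
    moreover have "F p w ! p = F p w ! p'" using nth w eq by metis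
    ultimately show "p = p'" using w by (simp add: nth_eq_iff_index_eq)
    then show "w = w'" using inv w eq by metis
  qed
  have "?F ` ?S = permutations_of_set (insert x A)"
  proof (rule card_subset_eq)
    show "?F ` ?S \<subseteq> permutations_of_set (insert x A)" using mem by auto
    show "card (?F ` ?S) = card (permutations_of_set (insert x A))"
      using A by (simp add: card_image[OF inj] card_cartesian_product mult_ac)
  qed simp
  then have "(\<Sum>u\<in>permutations_of_set (insert x A). f u) = sum f (?F ` ?S)" by simp
  also have "\<dots> = sum (f \<circ> ?F) ?S" by (rule sum.reindex[OF inj])
  also have "\<dots> = (\<Sum>(w, p)\<in>?S. f (F p w))" by (intro sum.cong) auto
  also have "\<dots> = (\<Sum>w\<in>permutations_of_set A. \<Sum>p\<le>card A. f (F p w))"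
    by (simp add: sum.cartesian_product)
  finally show ?thesis .
qed

definition ins :: "nat \<Rightarrow> 'a \<Rightarrow> 'a list \<Rightarrow> 'a list" where
  "ins p x w = take p w @ x # drop p w"

lemma sum_permutations_of_set_ins:
  fixes f :: "'b list \<Rightarrow> 'a::comm_monoid_add"
  assumes A: "finite A" "x \<notin> A"
  shows "(\<Sum>u\<in>permutations_of_set (insert x A). f u) =
    (\<Sum>w\<in>permutations_of_set A. \<Sum>p\<le>card A. f (ins p x w))"
proof (rule sum_permutations_of_set_insert[OF A, where G = "\<lambda>p u. take p u @ drop (Suc p) u"])
  fix p w assume p: "p \<le> card A" and w: "w \<in> permutations_of_set A"
  have l: "length w = card A" and d: "distinct w" and s: "set w = A"
    using w by (auto dest: permutations_of_setD length_finite_permutations_of_set)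
  have "mset (take p w) + mset (drop p w) = mset w" by (simp flip: mset_append)
  then have "mset (ins p x w) = add_mset x (mset w)" by (simp add: ins_def)
  then show "ins p x w \<in> permutations_of_set (insert x A)"
    using d s A by (metis distinct.simps(2) list.simps(15) mset.simps(2) mset_eq_imp_distinct_iff
        mset_eq_setD permutations_of_setI)
  show "ins p x w ! p = x" "take p (ins p x w) @ drop (Suc p) (ins p x w) = w"
    using p l by (auto simp: ins_def nth_append)
qed

section \<open>Descents and major index\<close>

definition des_maj_gf :: "'a::comm_semiring_1 \<Rightarrow> nat \<Rightarrow> int \<Rightarrow> 'a" where
  "des_maj_gf q n k = (\<Sum>w\<in>perms n. if int (des w) = k then q ^ maj w else 0)"

lemma entry_ins:
  assumes "p \<le> length w" "1 \<le> i" "i \<le> Suc (length w)"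
  shows "entry (ins p x w) i = (if i \<le> p then entry w i else if i = Suc p then x else entry w (i - 1))"
proof -
  consider "i \<le> p" | "i = Suc p" | "Suc p < i" by linarith
  then show ?thesis
  proof cases
    case 3
    then have "i - 1 - p = Suc (i - 2 - p)" "p + (i - 2 - p) = i - 2" using assms by auto
    then show ?thesis using assms 3 by (simp add: entry_def ins_def nth_append numeral_2_eq_2)
  qed (use assms in \<open>auto simp: entry_def ins_def nth_append\<close>)
qed

lemma Des_subset: "Des w \<subseteq> {1..<length w}"
  by (auto simp: Des_def)

text \<open>
  A largest letter makes a descent with its right neighbour, destroys the descent at the slot, and
  shifts the descents behind it.
\<close>

lemma Des_ins:
  assumes p: "p \<le> length w" and x: "\<And>y. y \<in> set w \<Longrightarrow> y < x"
  shows "Des (ins p x w) = {d \<in> Des w. d < p} \<union> (if p < length w then {Suc p} else {})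
    \<union> Suc ` {d \<in> Des w. p < d}"
proof -
  have l: "length (ins p x w) = Suc (length w)" using p by (simp add: ins_def)
  have e: "entry w i < x" if "1 \<le> i" "i \<le> length w" for i
    using that x by (auto simp: entry_def)
  have S: "i \<in> Suc ` {d \<in> Des w. p < d} \<longleftrightarrow> i - 1 \<in> Des w \<and> Suc p < i" for i
    by (cases i) auto
  have "i \<in> Des (ins p x w) \<longleftrightarrow> i \<in> {d \<in> Des w. d < p} \<or> (p < length w \<and> i = Suc p) 
     \<or> i \<in> Suc ` {d \<in> Des w. p < d}" for i
  proof (cases "1 \<le> i \<and> i \<le> length w")
    case False
    then show ?thesis using l S[of i] by (auto simp: Des_def)
  next
    case True
    then have e1: "entry (ins p x w) i = (if i \<le> p then entry w i else if i = Suc p then x else entry w (i - 1))"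
      "entry (ins p x w) (i + 1) = (if i + 1 \<le> p then entry w (i+1) else if i = p then x else entry w i)"
      using entry_ins[OF p, of i] entry_ins[OF p, of "i + 1"] by auto
    consider "i < p" | "i = p" | "i = Suc p" | "Suc p < i" by linarith
    then show ?thesis
    proof cases
      case 1
      then show ?thesis using True p e1 l S[of i] by (auto simp: Des_def)
    next
      case 2
      then show ?thesis using True p e1 l S[of i] e[of i] by (auto simp: Des_def)
    next
      case 3
      then show ?thesis using True p e1 l S[of i] e[of i] by (auto simp: Des_def)
    next
      case 4
      then show ?thesis using True p e1 l S[of i] by (auto simp: Des_def)
    qed
  qed
  then show ?thesis by auto
qed

lemma des_maj_ins:
  assumes p: "p \<le> length w" and x: "\<And>y. y \<in> set w \<Longrightarrow> y < x"
  shows "des (ins p x w) = (if p \<in> Des w \<or> p = length w then des w else Suc (des w))" (is ?des)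
    and "maj (ins p x w) = maj w + (if p = length w then 0
      else if p \<in> Des w then card {d \<in> Des w. p \<le> d} else Suc p + card {d \<in> Des w. p < d})" (is ?maj)
proof -
  let ?D = "Des w"
  let ?L = "{d \<in> ?D. d < p}" and ?U = "{d \<in> ?D. p < d}" 
  let ?M = "if p < length w then {Suc p} else {}"
  have fin: "finite ?D" by (rule finite_subset[OF Des_subset]) simp
  have D: "?D = ?L \<union> (if p \<in> ?D then {p} else {}) \<union> ?U"
    by (auto simp: not_less_iff_gr_or_eq)
  have U: "Suc ` ?U \<inter> (?L \<union> ?M) = {}" "?L \<inter> ?M = {}" by auto
  have U': "?U \<inter> (?L \<union> (if p \<in> ?D then {p} else {})) = {}" "?L \<inter> (if p \<in> ?D then {p} else {}) = {}" by auto
  have D': "Des (ins p x w) = ?L \<union> ?M \<union> Suc ` ?U" by (rule Des_ins[OF assms])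
  have d1: "des (ins p x w) = card ?L + card ?M + card ?U"
  proof -
    have "des (ins p x w) = card (?L \<union> ?M) + card (Suc ` ?U)"
      unfolding des_def D' by (rule card_Un_disjoint) (use fin U in auto)
    moreover have "card (?L \<union> ?M) = card ?L + card ?M"
      by (rule card_Un_disjoint) (use fin in auto)
    ultimately show ?thesis by (simp add: card_image)
  qed
  have d2: "des w = card ?L + (if p \<in> ?D then 1 else 0) + card ?U"
  proof -
    let ?N = "if p \<in> ?D then {p} else {}"
    have "des w = card (?L \<union> ?N) + card ?U"
      unfolding des_def apply (subst D) by (rule card_Un_disjoint) (use fin in auto)
    moreover have "card (?L \<union> ?N) = card ?L + card ?N"
      by (rule card_Un_disjoint) (use fin in auto)
    ultimately show ?thesis by simp
  qed
  have m1: "maj (ins p x w) = \<Sum>?L + \<Sum>?M + (\<Sum>?U + card ?U)"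
  proof -
    have "\<Sum>(Suc ` ?U) = \<Sum>?U + card ?U"
      by (simp add: sum.reindex sum_Suc)
    moreover have "maj (ins p x w) = \<Sum>(?L \<union> ?M) + \<Sum>(Suc ` ?U)"
      unfolding maj_def D' by (rule sum.union_disjoint) (use fin U in auto)
    moreover have "\<Sum>(?L \<union> ?M) = \<Sum>?L + \<Sum>?M"
      by (rule sum.union_disjoint) (use fin in auto)
    ultimately show ?thesis by simp
  qed
  have m2: "maj w = \<Sum>?L + (if p \<in> ?D then p else 0) + \<Sum>?U"
  proof -
    let ?N = "if p \<in> ?D then {p} else {}"
    have "maj w = \<Sum>(?L \<union> ?N) + \<Sum>?U"
      unfolding maj_def apply (subst D) by (rule sum.union_disjoint) (use fin in auto)
    moreover have "\<Sum>(?L \<union> ?N) = \<Sum>?L + \<Sum>?N"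
      by (rule sum.union_disjoint) (use fin in auto)
    ultimately show ?thesis by simp
  qed
  have c: "card {d \<in> ?D. p \<le> d} = Suc (card ?U)" if "p \<in> ?D"
  proof -
    have "{d \<in> ?D. p \<le> d} = insert p ?U" using that by auto
    then show ?thesis using fin by simp
  qed
  have top: "p = length w \<Longrightarrow> p \<notin> ?D \<and> card ?U = 0" and lt: "p \<in> ?D \<Longrightarrow> p < length w"
    using Des_subset[of w] by (auto intro!: arg_cong[of _ "{}" card, simplified])
  show ?des using p d1 d2 top lt by auto
  show ?maj using p m1 m2 top lt c by (cases "p = length w"; cases "p \<in> ?D") auto
qed

text \<open>
  Inserting the new maximum at a descent raises \<open>maj\<close> by the rank of that descent counted from the
  right: the exponents are \<open>1, \<dots>, |D|\<close>.
\<close>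

lemma sum_power_card_ge:
  fixes q :: "'a::comm_semiring_1" and D :: "nat set"
  assumes "finite D"
  shows "(\<Sum>p\<in>D. q ^ card {d \<in> D. p \<le> d}) = q * (\<Sum>l<card D. q ^ l)"
  using assms
proof (induction rule: finite_linorder_max_induct)
  case empty
  then show ?case by simp
next
  case (insert b D)
  have b: "b \<notin> D" using insert by auto
  have "{d. (d = b \<or> d \<in> D) \<and> b \<le> d} = {b}" using insert by auto
  moreover have "card {d. (d = b \<or> d \<in> D) \<and> p \<le> d} = Suc (card {d \<in> D. p \<le> d})" if "p \<in> D" for p
  proof -
    have "{d. (d = b \<or> d \<in> D) \<and> p \<le> d} = Set.insert b {d \<in> D. p \<le> d}" using that insert by fastforce
    then show ?thesis using insert b by simp
  qed
  ultimately have "(\<Sum>p\<in>Set.insert b D. q ^ card {d \<in> Set.insert b D. p \<le> d}) 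
      = q + q * (\<Sum>p\<in>D. q ^ card {d \<in> D. p \<le> d})"
    using insert.hyps b by (simp add: sum_distrib_left)
  also have "\<dots> = q * (1 + q * (\<Sum>l<card D. q ^ l))"
    unfolding insert.IH by (simp add: distrib_left)
  also have "1 + q * (\<Sum>l<card D. q ^ l) = (\<Sum>l<Suc (card D). q ^ l)"
    by (simp add: sum.lessThan_Suc_shift sum_distrib_left del: sum.lessThan_Suc)
  finally show ?case using insert b by simp
qed

text \<open>
  Inserting the new maximum at a slot \<open>p\<close> that is neither a descent nor the end raises \<open>maj\<close> by
  \<open>p + 1\<close> and by \<open>1\<close> for each descent behind \<open>p\<close>. This increment grows strictly with \<open>p\<close>, so that its
  \<open>n - |D|\<close> values are exactly \<open>|D| + 1, \<dots>, n\<close>.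
\<close>

lemma sum_power_card_gt:
  fixes q :: "'a::comm_semiring_1"
  assumes "D \<subseteq> {..<n}"
  shows "(\<Sum>p\<in>{..<n} - D. q ^ (Suc p + card {d \<in> D. p < d}))
       = q ^ Suc (card D) * (\<Sum>l<n - card D. q ^ l)"
  using assms
proof (induction n arbitrary: D)
  case 0
  then show ?case by simp
next
  case (Suc n)
  show ?case
  proof (cases "n \<in> D")
    case True
    define E where "E = D - {n}"
    have E: "D = insert n E" "n \<notin> E" "E \<subseteq> {..<n}" "finite E"
      using True Suc.prems unfolding E_def by (auto simp: less_Suc_eq intro: finite_subset)
    have "card {d \<in> D. p < d} = Suc (card {d \<in> E. p < d})" if "p < n" for p
    proof -
      have "{d \<in> D. p < d} = insert n {d \<in> E. p < d}" using that E by auto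
      then show ?thesis using E by simp
    qed
    moreover have "{..<Suc n} - D = {..<n} - E" using E by auto
    ultimately have "(\<Sum>p\<in>{..<Suc n} - D. q ^ (Suc p + card {d \<in> D. p < d}))
      = q * (\<Sum>p\<in>{..<n} - E. q ^ (Suc p + card {d \<in> E. p < d}))"
      by (simp add: sum_distrib_left)
    then show ?thesis using Suc.IH[OF E(3)] E by (simp add: mult_ac)
  next
    case False
    then have D: "D \<subseteq> {..<n}" using Suc.prems by (auto simp: less_Suc_eq)
    then have fin: "finite D" and c: "card D \<le> n"
      using card_mono[OF _ D] by (auto intro: finite_subset)
    have "{..<Suc n} - D = insert n ({..<n} - D)" "{d \<in> D. n < d} = {}" using D False by auto
    moreover from this(2) have c0: "card {d \<in> D. n < d} = 0" by (metis card.empty)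
    ultimately have "(\<Sum>p\<in>{..<Suc n} - D. q ^ (Suc p + card {d \<in> D. p < d}))
      = q ^ Suc n + (\<Sum>p\<in>{..<n} - D. q ^ (Suc p + card {d \<in> D. p < d}))"
      by (simp add: c0)
    then show ?thesis using Suc.IH[OF D] c
      by (simp add: Suc_diff_le distrib_left mult.assoc add.commute flip: power_add)
  qed
qed

lemma des_maj_gf_0: "des_maj_gf q 0 k = (if k = 0 then 1 else 0)"
  by (simp add: des_maj_gf_def des_def maj_def Des_def)

text \<open>
  With \<open>d\<close> descents, the end slot and the \<open>d\<close> descent slots keep \<open>des\<close> and raise \<open>maj\<close> by
  \<open>0, \<dots>, d\<close>; the other slots raise \<open>des\<close> by one and \<open>maj\<close> by \<open>d + 1, \<dots>, n\<close>.
\<close>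

lemma des_maj_gf_Suc:
  fixes q :: "'a::comm_semiring_1"
  shows "des_maj_gf q (Suc n) k =
    qnum q (k + 1) * des_maj_gf q n k + q ^ nat k * qnum q (int n + 1 - k) * des_maj_gf q n (k - 1)"
proof -
  have ins_eq: "{1..Suc n} = insert (Suc n) {1..n}" by auto
  have slots: "(\<Sum>p\<le>n. if int (des (ins p (Suc n) w)) = k then q ^ maj (ins p (Suc n) w) else 0) =
      qnum q (k + 1) * (if int (des w) = k then q ^ maj w else 0)
      + q ^ nat k * qnum q (int n + 1 - k) * (if int (des w) = k - 1 then q ^ maj w else 0)"
    if w: "w \<in> perms n" for w
  proof -
    let ?D = "Des w"
    let ?g = "\<lambda>p. if int (des (ins p (Suc n) w)) = k then q ^ maj (ins p (Suc n) w) else 0"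
    have l: "length w = n" and lt: "\<And>y. y \<in> set w \<Longrightarrow> y < Suc n"
      using w by (auto dest: permutations_of_setD length_finite_permutations_of_set)
    have D: "?D \<subseteq> {..<n}" using Des_subset[of w] l by auto
    then have fin: "finite ?D" by (rule finite_subset) simp
    have dm: "des (ins p (Suc n) w) = (if p \<in> Des w \<or> p = n then des w else Suc (des w))"
      "maj (ins p (Suc n) w) = maj w + (if p = n then 0
      else if p \<in> Des w then card {d \<in> Des w. p \<le> d} else Suc p + card {d \<in> Des w. p < d})"
      if "p \<le> n" for p using des_maj_ins[of p w "Suc n"] l lt that by auto
    have split: "{..n} = insert n (?D \<union> ({..<n} - ?D))" using D by auto
    have "(\<Sum>p\<le>n. ?g p) = ?g n + (\<Sum>p\<in>?D. ?g p) + (\<Sum>p\<in>{..<n} - ?D. ?g p)"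
    proof -
      have "(\<Sum>p\<in>?D \<union> ({..<n} - ?D). ?g p) = (\<Sum>p\<in>?D. ?g p) + (\<Sum>p\<in>{..<n} - ?D. ?g p)"
        by (rule sum.union_disjoint) (use fin in auto)
      moreover have "n \<notin> ?D \<union> ({..<n} - ?D)" using D by auto
      ultimately show ?thesis unfolding split using fin by (simp add: add.assoc)
    qed
    also have "?g n = (if int (des w) = k then q ^ maj w else 0)"
      using dm[of n] by simp
    also have "(\<Sum>p\<in>?D. ?g p) = (if int (des w) = k then q ^ maj w else 0) * (\<Sum>p\<in>?D. q ^ card {d \<in> ?D. p \<le> d})"
      unfolding sum_distrib_left using D by (intro sum.cong refl) (auto simp: dm power_add mult_ac)
    also have "\<dots> = (if int (des w) = k then q ^ maj w else 0) * (q * qnum q k)"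
      unfolding sum_power_card_ge[OF fin] by (auto simp: qnum_def des_def)
    also have "(\<Sum>p\<in>{..<n} - ?D. ?g p) = (if int (des w) = k - 1 then q ^ maj w else 0) *
       (\<Sum>p\<in>{..<n} - ?D. q ^ (Suc p + card {d \<in> ?D. p < d}))"
      unfolding sum_distrib_left using D by (intro sum.cong refl) (auto simp: dm power_add mult_ac)
    also have "\<dots> = (if int (des w) = k - 1 then q ^ maj w else 0) * (q ^ nat k * qnum q (int n + 1 - k))"
    proof (cases "int (des w) = k - 1")
      case True
      then have "nat k = Suc (card ?D)" "nat (int n + 1 - k) = n - card ?D" by (auto simp: des_def)
      then show ?thesis unfolding sum_power_card_gt[OF D] qnum_def by simp
    qed simp
    also have "(if int (des w) = k then q ^ maj w else 0)
        + (if int (des w) = k then q ^ maj w else 0) * (q * qnum q k)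
       = qnum q (k + 1) * (if int (des w) = k then q ^ maj w else 0)"
    proof (cases "int (des w) = k")
      case True
      then have "0 \<le> k" by simp
      from qnum_plus_1_left[OF this, of q] show ?thesis by (simp add: distrib_right mult_ac)
    qed simp
    finally show ?thesis by (simp add: mult_ac)
  qed
  have "des_maj_gf q (Suc n) k = (\<Sum>w\<in>perms n. \<Sum>p\<le>n.
      if int (des (ins p (Suc n) w)) = k then q ^ maj (ins p (Suc n) w) else 0)"
    unfolding des_maj_gf_def ins_eq by (subst sum_permutations_of_set_ins) auto
  also have "\<dots> = qnum q (k + 1) * des_maj_gf q n k + q ^ nat k * qnum q (int n + 1 - k) * des_maj_gf q n (k - 1)"
    by (simp add: slots des_maj_gf_def sum.distrib sum_distrib_left)
  finally show ?thesis .
qed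

lemma des_maj_gf_eq_walk_gf: "des_maj_gf q n k = walk_gf q n k 0"
  by (induction n arbitrary: k) (simp_all add: des_maj_gf_0 walk_gf_0 des_maj_gf_Suc walk_gf_height_0_Suc)

section \<open>Inversions of words above a sorted list\<close>

lemma inversions_Nil [simp]: "inversions [] = 0"
proof -
  have "{(i, j). 1 \<le> i \<and> i < j \<and> j \<le> length ([] :: nat list) \<and> entry ([] :: nat list) i > entry [] j} = {}"
    by auto
  then show ?thesis unfolding inversions_def by (metis card.empty)
qed

lemma inversions_Cons: "inversions (x # w) = length (filter (\<lambda>y. y < x) w) + inversions w"
proof -
  let ?A = "{i. i < length w \<and> w ! i < x}"
  let ?B = "{(i, j). 1 \<le> i \<and> i < j \<and> j \<le> length w \<and> entry w i > entry w j}"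
  have fin: "finite ?B"
    by (rule finite_subset[of _ "{..length w} \<times> {..length w}"]) auto
  have "{(i, j). 1 \<le> i \<and> i < j \<and> j \<le> length (x # w) \<and> entry (x # w) i > entry (x # w) j}
    = (\<lambda>i. (1, Suc (Suc i))) ` ?A \<union> map_prod Suc Suc ` ?B" (is "?C = ?A' \<union> ?B'")
  proof (intro equalityI subsetI)
    fix z assume "z \<in> ?C"
    then obtain i j where z: "z = (i, j)" "1 \<le> i" "i < j" "j \<le> Suc (length w)"
      "entry (x # w) i > entry (x # w) j" by auto
    show "z \<in> ?A' \<union> ?B'"
    proof (cases "i = 1")
      case True
      then have "z = (1, Suc (Suc (j - 2)))" "j - 2 \<in> ?A"
        using z by (auto simp: entry_def nth_Cons' numeral_2_eq_2)
      then show ?thesis by blast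
    next
      case False
      then have "z = map_prod Suc Suc (i - 1, j - 1)" "(i - 1, j - 1) \<in> ?B"
        using z by (auto simp: entry_def nth_Cons')
      then show ?thesis by blast
    qed
  next
    fix z assume "z \<in> ?A' \<union> ?B'"
    then show "z \<in> ?C" by (auto simp: entry_def nth_Cons')
  qed
  moreover have "card (?A' \<union> ?B') = card ?A' + card ?B'"
    by (rule card_Un_disjoint) (use fin in auto)
  moreover have "card ?A' = card ?A" by (rule card_image) (auto simp: inj_on_def)
  moreover have "card ?B' = card ?B" by (rule card_image) (auto simp: inj_on_def)
  ultimately show ?thesis by (simp add: inversions_def length_filter_conv_card)
qed

lemma inversions_ins_least:
  assumes "\<And>y. y \<in> set w \<Longrightarrow> x < y" "p \<le> length w"
  shows "inversions (ins p x w) = p + inversions w"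
  using assms
proof (induction w arbitrary: p)
  case Nil
  then show ?case by (simp add: ins_def inversions_Cons)
next
  case (Cons y w)
  show ?case
  proof (cases p)
    case 0
    have "filter (\<lambda>z. z < x) (y # w) = []" using Cons.prems by (force simp: filter_empty_conv)
    then show ?thesis by (simp add: 0 ins_def inversions_Cons[of x])
  next
    case (Suc p')
    have "length (filter P (take p' w)) + length (filter P (drop p' w)) = length (filter P w)" for P :: "nat \<Rightarrow> bool"
      by (metis append_take_drop_id filter_append length_append)
    moreover have "x < y" using Cons.prems by auto
    ultimately have "length (filter (\<lambda>z. z < y) (ins p' x w)) = Suc (length (filter (\<lambda>z. z < y) w))"
      by (simp add: ins_def)
    moreover have "ins p x (y # w) = y # ins p' x w" by (simp add: Suc ins_def)
    ultimately show ?thesis using Cons.IH[of p'] Cons.prems Suc by (simp add: inversions_Cons)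
  qed
qed

lemma nth_less_iff_less_card:
  fixes xs :: "'a::linorder list"
  assumes "sorted xs" "distinct xs" "p < length xs"
  shows "xs ! p < m \<longleftrightarrow> p < card {x \<in> set xs. x < m}"
proof -
  have "card {x \<in> set xs. x < m} = length (filter (\<lambda>x. x < m) xs)"
    using distinct_card[OF distinct_filter[OF assms(2)], of "\<lambda>x. x < m"] by simp
  moreover have "xs ! p < m \<longleftrightarrow> p < length (filter (\<lambda>x. x < m) xs)"
    using assms(1,3)
  proof (induction xs arbitrary: p)
    case Nil
    then show ?case by simp
  next
    case (Cons x xs)
    show ?case
    proof (cases "x < m")
      case True
      then show ?thesis using Cons by (cases p) auto
    next
      case False
      then have "filter (\<lambda>y. y < m) (x # xs) = []" "\<not> (x # xs) ! p < m"
        using Cons.prems by (auto simp: filter_empty_conv nth_Cons split: nat.splits)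
          (meson nth_mem order_le_less_trans)
      then show ?thesis by simp
    qed
  qed
  ultimately show ?thesis by simp
qed

text \<open>
  Inserting a letter consumes the bound at its slot and leaves the order of the other bounds intact.
\<close>

lemma list_all2_ins:
  assumes "length xs = Suc (length w)" "p \<le> length w"
  shows "list_all2 R xs (ins p x w) \<longleftrightarrow> R (xs ! p) x \<and> list_all2 R (take p xs @ drop (Suc p) xs) w"
proof -
  have "xs = take p xs @ xs ! p # drop (Suc p) xs" using assms by (simp add: id_take_nth_drop)
  then have "list_all2 R xs (ins p x w) \<longleftrightarrow> 
    list_all2 R (take p xs @ xs ! p # drop (Suc p) xs) (take p w @ x # drop p w)"
    by (simp add: ins_def)
  also have "\<dots> \<longleftrightarrow> R (xs ! p) x \<and> list_all2 R (take p xs @ drop (Suc p) xs) (take p w @ drop p w)"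
    using assms by (subst (1 2) list_all2_append) auto
  finally show ?thesis by simp
qed

text \<open>
  The smallest letter \<open>m\<close> may be inserted at slot \<open>p\<close> iff the bound there is less than \<open>m\<close>. The bounds
  are sorted, so these slots are \<open>0, \<dots>, c - 1\<close> with \<open>c\<close> the number of bounds below \<open>m\<close>, and slot
  \<open>p\<close> creates \<open>p\<close> inversions: a factor \<open>[c]\<close>. The bound used up is less than every other letter, so
  for each of them both terms of the height drop by one, whichever slot was chosen.
\<close>

lemma sum_inversions_above_bounds:
  fixes q :: "'a::comm_semiring_1" and J :: "nat set"
  assumes "finite J" "sorted xs" "distinct xs" "length xs = card J"
  shows "(\<Sum>u\<in>permutations_of_set J. if list_all2 (<) xs u then q ^ inversions u else 0)
    = (\<Prod>j\<in>J. qnum q (height (set xs) J j))"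
  using assms
proof (induction J arbitrary: xs rule: finite_linorder_min_induct)
  case empty
  then show ?case by simp
next
  case (insert m J)
  let ?xs = "\<lambda>p. take p xs @ drop (Suc p) xs"
  let ?P = "\<Prod>j\<in>J. qnum q (height (set xs) (Set.insert m J) j)"
  have m: "m \<notin> J" using insert.hyps by auto
  have l: "length xs = Suc (card J)" using insert m by simp
  have drop1: "(\<Sum>w\<in>permutations_of_set J. if list_all2 (<) (?xs p) w then q ^ inversions w else 0) = ?P"
    if p: "p \<le> card J" and pm: "xs ! p < m" for p
  proof -
    have xs: "xs = take p xs @ xs ! p # drop (Suc p) xs" using p l by (simp add: id_take_nth_drop)
    have "sorted (?xs p)" "distinct (?xs p)"
      using insert.prems(1,2) by (subst (asm) (1 2) xs, auto simp: sorted_append)+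
    moreover have "length (?xs p) = card J" using p l by simp
    ultimately have "(\<Sum>w\<in>permutations_of_set J. if list_all2 (<) (?xs p) w then q ^ inversions w else 0)
      = (\<Prod>j\<in>J. qnum q (height (set (?xs p)) J j))"
      by (rule insert.IH)
    also have "\<dots> = ?P"
    proof (intro prod.cong refl arg_cong[of _ _ "qnum q"])
      fix j assume j: "j \<in> J"
      have mj: "m < j" using insert.hyps j by auto
      have s: "set xs = Set.insert (xs ! p) (set (?xs p))" by (subst xs) auto
      have n: "xs ! p \<notin> set (?xs p)" using insert.prems(2) by (subst (asm) xs) auto
      have "{i \<in> set xs. i < j} = Set.insert (xs ! p) {i \<in> set (?xs p). i < j}"
        using pm mj s by auto
      then have "card {i \<in> set xs. i < j} = Suc (card {i \<in> set (?xs p). i < j})"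
        using n by simp
      moreover have "{i \<in> Set.insert m J. i < j} = Set.insert m {i \<in> J. i < j}"
        using mj by auto
      then have "card {i \<in> Set.insert m J. i < j} = Suc (card {i \<in> J. i < j})"
        using m insert.hyps by simp
      ultimately show "height (set (?xs p)) J j = height (set xs) (Set.insert m J) j"
        by (simp add: height_def)
    qed
    finally show ?thesis .
  qed
  have term_eq: "(if list_all2 (<) xs (ins p m w) then q ^ inversions (ins p m w) else 0) =
      (if xs ! p < m then q ^ p * (if list_all2 (<) (?xs p) w then q ^ inversions w else 0) else 0)"
    if "w \<in> permutations_of_set J" "p \<le> card J" for w p
  proof -
    have "length w = card J" "set w = J" using that by (auto dest: permutations_of_setD length_finite_permutations_of_set)
    moreover have "inversions (ins p m w) = p + inversions w"
      by (rule inversions_ins_least) (use calculation that insert.hyps in auto)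
    ultimately show ?thesis using that l by (simp add: list_all2_ins power_add)
  qed
  have "(\<Sum>u\<in>permutations_of_set (Set.insert m J). if list_all2 (<) xs u then q ^ inversions u else 0)
    = (\<Sum>w\<in>permutations_of_set J. \<Sum>p\<le>card J. if list_all2 (<) xs (ins p m w) then q ^ inversions (ins p m w) else 0)"
    by (rule sum_permutations_of_set_ins) (use insert.hyps m in auto)
  also have "\<dots> = (\<Sum>w\<in>permutations_of_set J. \<Sum>p\<le>card J. 
      if xs ! p < m then q ^ p * (if list_all2 (<) (?xs p) w then q ^ inversions w else 0) else 0)"
    by (intro sum.cong refl term_eq) auto
  also have "\<dots> = (\<Sum>p\<le>card J. if xs ! p < m then q ^ p *
     (\<Sum>w\<in>permutations_of_set J. if list_all2 (<) (?xs p) w then q ^ inversions w else 0) else 0)"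
    by (subst sum.swap) (intro sum.cong refl, simp add: sum_distrib_left)
  also have "\<dots> = (\<Sum>p\<le>card J. if xs ! p < m then q ^ p * ?P else 0)"
    by (intro sum.cong refl if_cong) (simp add: drop1)
  also have "\<dots> = (\<Sum>p\<in>{p\<in>{..card J}. xs ! p < m}. q ^ p * ?P)"
    by (rule sum.inter_filter[symmetric]) simp
  also have "\<dots> = (\<Sum>p\<in>{p\<in>{..card J}. xs ! p < m}. q ^ p) * ?P"
    by (simp add: sum_distrib_right)
  also have "{p\<in>{..card J}. xs ! p < m} = {..<card {i \<in> set xs. i < m}}"
  proof -
    have "card {i \<in> set xs. i < m} \<le> length xs"
      by (metis (no_types, lifting) List.finite_set card_length card_mono mem_Collect_eq order_trans subsetI)
    then show ?thesis
      using nth_less_iff_less_card[OF insert.prems(1,2)] l by (auto simp: less_Suc_eq_le)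
  qed
  also have "(\<Sum>p<card {i \<in> set xs. i < m}. q ^ p) = qnum q (height (set xs) (Set.insert m J) m)"
  proof -
    have "{j \<in> Set.insert m J. j < m} = {}" using insert.hyps by auto
    then show ?thesis by (simp add: height_def qnum_def del: Collect_empty_eq)
  qed
  finally show ?case using insert.hyps m by simp
qed

section \<open>Sorting index of words below a sorted list\<close>

lemma position_entry:
  assumes "distinct w" "1 \<le> i" "i \<le> length w"
  shows "position w (entry w i) = i"
  unfolding position_def
proof (rule the_equality)
  fix j assume "1 \<le> j \<and> j \<le> length w \<and> entry w j = entry w i"
  moreover have "i - 1 < length w" "j - 1 < length w" using assms calculation by linarith+
  ultimately have "j - 1 = i - 1" using assms by (simp add: entry_def nth_eq_iff_index_eq)
  then show "j = i" using assms \<open>1 \<le> j \<and> _\<close> by linarith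
qed (use assms in auto)

lemma mset_exchange:
  assumes "1 \<le> i" "i \<le> length w" "1 \<le> j" "j \<le> length w"
  shows "mset (exchange w i j) = mset w"
proof -
  have "exchange w i j = w[i - 1 := w ! (j - 1), j - 1 := w ! (i - 1)]"
    by (simp add: exchange_def entry_def)
  then show ?thesis using assms by (simp add: mset_swap)
qed

lemma exchange_exchange:
  assumes "1 \<le> i" "i \<le> length w" "1 \<le> j" "j \<le> length w"
  shows "exchange (exchange w i j) i j = w"
  using assms by (auto simp: exchange_def entry_def nth_list_update list_eq_iff_nth_eq)

lemma exchange_append:
  assumes "1 \<le> i" "i \<le> length w" "1 \<le> j" "j \<le> length w"
  shows "exchange (w @ z) i j = exchange w i j @ z"
proof -
  have "i - 1 < length w" "j - 1 < length w" using assms by linarith+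
  then show ?thesis by (simp add: exchange_def entry_def nth_append list_update_append)
qed

lemma entry_append: "1 \<le> i \<Longrightarrow> i \<le> length w \<Longrightarrow> entry (w @ z) i = entry w i"
  unfolding entry_def by (subst nth_append) auto

text \<open>
  The steps \<open>r, \<dots>, 1\<close> never touch what has already been moved to its final place at the end.
\<close>

lemma selection_cost_append:
  assumes "r \<le> length w" "distinct (w @ z)" "distinct a" "set a = set w"
  shows "selection_cost (a @ y) r (w @ z) = selection_cost a r w"
  using assms
proof (induction r arbitrary: w)
  case 0
  then show ?case by simp
next
  case (Suc r)
  have la: "length a = length w" using Suc.prems by (metis distinct_append distinct_card)
  have "entry a (Suc r) \<in> set w" using Suc.prems la by (auto simp: entry_def)
  then obtain i0 where i0: "i0 < length w" "w ! i0 = entry a (Suc r)" by (auto simp: in_set_conv_nth)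
  define i where "i = Suc i0"
  have i: "1 \<le> i" "i \<le> length w" "entry w i = entry a (Suc r)"
    using i0 by (auto simp: i_def entry_def)
  have p: "position w (entry a (Suc r)) = i" "position (w @ z) (entry a (Suc r)) = i"
    using position_entry[of w i] position_entry[of "w @ z" i] i Suc.prems by (auto simp: entry_append)
  have e: "entry (a @ y) (Suc r) = entry a (Suc r)" using Suc.prems la by (simp add: entry_append)
  have m: "mset (exchange w i (Suc r)) = mset w" using i Suc.prems by (intro mset_exchange) auto
  then have "set (exchange w i (Suc r)) = set w" "length (exchange w i (Suc r)) = length w"
    "distinct (exchange w i (Suc r))"
    using Suc.prems by (auto dest: mset_eq_setD mset_eq_length mset_eq_imp_distinct_iff)
  then have "selection_cost (a @ y) r (exchange w i (Suc r) @ z) = selection_cost a r (exchange w i (Suc r))"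
    using Suc.prems by (intro Suc.IH) auto
  moreover have "exchange (w @ z) i (Suc r) = exchange w i (Suc r) @ z"
    using i Suc.prems by (intro exchange_append) auto
  ultimately show ?case by (simp add: p e Let_def)
qed

text \<open>
  The state before an exchange of the sort that moved \<open>x\<close> from position \<open>p + 1\<close> to the position behind
  \<open>w\<close>.
\<close>

definition unsort_step :: "nat \<Rightarrow> 'a \<Rightarrow> 'a list \<Rightarrow> 'a list" where
  "unsort_step p x w = exchange (w @ [x]) (Suc p) (Suc (length w))"

lemma unsort_step_length [simp]: "length (unsort_step p x w) = Suc (length w)"
  by (simp add: unsort_step_def exchange_def)

lemma unsort_step_nth:
  assumes "p \<le> length w"
  shows "unsort_step p x w ! p = x"
    and "i \<noteq> p \<Longrightarrow> i < length w \<Longrightarrow> unsort_step p x w ! i = w ! i"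
    and "p < length w \<Longrightarrow> unsort_step p x w ! length w = w ! p"
  using assms by (auto simp: unsort_step_def exchange_def entry_def nth_list_update nth_append)

lemma mset_unsort_step: "p \<le> length w \<Longrightarrow> mset (unsort_step p x w) = add_mset x (mset w)"
  by (simp add: unsort_step_def mset_exchange)

lemma exchange_unsort_step:
  "p \<le> length w \<Longrightarrow> exchange (unsort_step p x w) (Suc p) (Suc (length w)) = w @ [x]"
  unfolding unsort_step_def by (rule exchange_exchange) auto

lemma sum_permutations_of_set_unsort_step:
  fixes f :: "'b list \<Rightarrow> 'a::comm_monoid_add"
  assumes A: "finite A" "x \<notin> A"
  shows "(\<Sum>u\<in>permutations_of_set (insert x A). f u) =
    (\<Sum>w\<in>permutations_of_set A. \<Sum>p\<le>card A. f (unsort_step p x w))"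
proof (rule sum_permutations_of_set_insert[OF A,
    where G = "\<lambda>p u. butlast (exchange u (Suc p) (Suc (card A)))"])
  fix p w assume p: "p \<le> card A" and w: "w \<in> permutations_of_set A"
  have l: "length w = card A" and d: "distinct w" and s: "set w = A"
    using w by (auto dest: permutations_of_setD length_finite_permutations_of_set)
  have "mset (unsort_step p x w) = mset (x # w)" using p l by (simp add: mset_unsort_step)
  then show "unsort_step p x w \<in> permutations_of_set (insert x A)"
    using d s A by (metis distinct.simps(2) list.simps(15) mset_eq_imp_distinct_iff
        mset_eq_setD permutations_of_setI)
  show "unsort_step p x w ! p = x" using p l by (simp add: unsort_step_nth)
  show "butlast (exchange (unsort_step p x w) (Suc p) (Suc (card A))) = w"
    using exchange_unsort_step[of p w x] p l by simp
qed

lemma sor_unsort_step: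
  assumes w: "distinct w" and M: "\<And>y. y \<in> set w \<Longrightarrow> y < M" and p: "p \<le> length w"
  shows "sor (unsort_step p M w) = (length w - p) + sor w"
proof -
  let ?v = "unsort_step p M w" and ?a = "sorted_list_of_set (set w)"
  have M': "M \<notin> set w" using M by blast
  have "mset ?v = mset (M # w)" using p by (simp add: mset_unsort_step)
  then have v: "set ?v = insert M (set w)" "distinct ?v"
    using w M' by (metis list.simps(15) mset_eq_setD, metis distinct.simps(2) mset_eq_imp_distinct_iff)
  have la: "length ?a = length w" using w by (simp add: distinct_card)
  have a: "sorted_list_of_set (set ?v) = ?a @ [M]"
    unfolding v(1)
  proof (rule sorted_distinct_set_unique)
    show "sorted (?a @ [M])" using M by (auto simp: sorted_append intro: less_imp_le)
    show "distinct (?a @ [M])" using M' by simp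
    show "set (sorted_list_of_set (insert M (set w))) = set (?a @ [M])"
      by (subst set_sorted_list_of_set) simp_all
  qed (rule sorted_sorted_list_of_set, rule distinct_sorted_list_of_set)
  have eM: "entry (?a @ [M]) (Suc (length w)) = M" using la by (simp add: entry_def nth_append)
  have ev: "entry ?v (Suc p) = M" using p by (simp add: entry_def unsort_step_nth)
  have pos: "position ?v M = Suc p"
    using position_entry[of ?v "Suc p"] v p by (simp add: ev)
  have "sor ?v = selection_cost (?a @ [M]) (Suc (length w)) ?v"
    by (simp add: sor_def a)
  also have "\<dots> = (length w - p) + selection_cost (?a @ [M]) (length w) (w @ [M])"
    using p by (simp add: eM pos Let_def exchange_unsort_step)
  also have "selection_cost (?a @ [M]) (length w) (w @ [M]) = sor w"
    unfolding sor_def by (rule selection_cost_append) (use w M' in auto)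
  finally show ?thesis .
qed

text \<open>
  Sorting \<open>M\<close> to the end brings one letter back to the place of \<open>M\<close>; a bound that admits \<open>M\<close> there
  admits this smaller letter too. Conversely, undoing the exchange puts that letter at the last
  place, where the bound is the largest of all.
\<close>

lemma list_all2_unsort_step:
  fixes M :: "'a::linorder"
  assumes ls: "sorted (ls @ [x])" "length ls = length w" and p: "p \<le> length w"
    and M: "\<And>k. k \<in> set w \<Longrightarrow> k \<le> M"
  shows "list_all2 (\<ge>) (ls @ [x]) (unsort_step p M w) \<longleftrightarrow> M \<le> (ls @ [x]) ! p \<and> list_all2 (\<ge>) ls w"
proof -
  have x: "l \<le> x" if "l \<in> set ls" for l using ls(1) that by (simp add: sorted_append)
  have "list_all2 (\<ge>) (ls @ [x]) (unsort_step p M w) \<longleftrightarrow> (\<forall>i\<le>length w. unsort_step p M w ! i \<le> (ls @ [x]) ! i)"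
    by (auto simp: list_all2_conv_all_nth ls less_Suc_eq_le)
  also have "\<dots> \<longleftrightarrow> M \<le> (ls @ [x]) ! p \<and> (\<forall>i<length w. w ! i \<le> ls ! i)"
  proof (cases "p = length w")
    case True
    have "(\<forall>i\<le>length w. P i) \<longleftrightarrow> P p \<and> (\<forall>i<length w. P i)" for P
      using True by (auto simp: le_less)
    then show ?thesis using unsort_step_nth[where p = p and w = w and x = M] True ls by (auto simp: nth_append)
  next
    case False
    then have pl: "p < length w" using p by simp
    have split: "(\<forall>i\<le>length w. P i) \<longleftrightarrow> P p \<and> P (length w) \<and> (\<forall>i<length w. i \<noteq> p \<longrightarrow> P i)" for P
      using pl by (auto simp: le_less)
    have split': "(\<forall>i<length w. P i) \<longleftrightarrow> P p \<and> (\<forall>i<length w. i \<noteq> p \<longrightarrow> P i)" for P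
      using pl by auto
    have "w ! p \<le> M" using M pl by simp
    moreover have "ls ! p \<le> x" using x ls pl by simp
    ultimately show ?thesis
      unfolding split split'[of "\<lambda>i. w ! i \<le> ls ! i"]
      using unsort_step_nth[where p = p and w = w and x = M] pl ls by (auto simp: nth_append)
  qed
  finally show ?thesis using ls(2) by (auto simp: list_all2_conv_all_nth)
qed

text \<open>
  The largest letter \<open>M\<close> may stand at any place whose bound is at least \<open>M\<close>. The bounds are sorted, so
  these are the last \<open>c\<close> places, with \<open>c\<close> the number of such bounds, and they cost \<open>0, \<dots>, c - 1\<close>: a
  factor \<open>[c]\<close>. Once \<open>M\<close> has been sorted to the end, the last bound \<open>x\<close> disappears with it, which
  lowers both counts of every other letter by one. This uses \<open>M \<le> x\<close>; otherwise \<open>M\<close> has no place at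
  all and both sides are \<open>0\<close>.
\<close>

lemma sum_sor_below_bounds:
  fixes q :: "'a::comm_semiring_1" and K :: "nat set"
  assumes "finite K" "sorted ls" "distinct ls" "length ls = card K"
  shows "(\<Sum>v\<in>permutations_of_set K. if list_all2 (\<ge>) ls v then q ^ sor v else 0)
    = (\<Prod>k\<in>K. qnum q (int (card {l \<in> set ls. k \<le> l}) - int (card {k' \<in> K. k < k'})))"
  using assms
proof (induction K arbitrary: ls rule: finite_linorder_max_induct)
  case empty
  then show ?case by (simp add: sor_def)
next
  case (insert M K)
  have M: "M \<notin> K" using insert.hyps by auto
  obtain ls' x where ls: "ls = ls' @ [x]" using insert.prems M insert.hyps by (cases ls rule: rev_exhaust) auto
  have l': "length ls' = card K" using insert.prems insert.hyps M ls by simp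
  have x: "x \<notin> set ls'" using insert.prems ls by auto
  let ?c = "card {l \<in> set ls. l < M}"
  let ?g = "\<lambda>w. if list_all2 (\<ge>) ls' w then q ^ sor w else 0"
  have "(\<Sum>v\<in>permutations_of_set (Set.insert M K). if list_all2 (\<ge>) ls v then q ^ sor v else 0)
    = (\<Sum>w\<in>permutations_of_set K. \<Sum>p\<le>card K. 
       if list_all2 (\<ge>) ls (unsort_step p M w) then q ^ sor (unsort_step p M w) else 0)"
    by (rule sum_permutations_of_set_unsort_step) (use insert.hyps M in auto)
  also have "\<dots> = (\<Sum>w\<in>permutations_of_set K. \<Sum>p\<le>card K. if M \<le> ls ! p then q ^ (card K - p) * ?g w else 0)"
  proof (intro sum.cong refl)
    fix w p assume w: "w \<in> permutations_of_set K" and p: "p \<in> {..card K}"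
    have lw: "length w = card K" and dw: "distinct w" and sw: "set w = K"
      using w by (auto dest: permutations_of_setD length_finite_permutations_of_set)
    have "sor (unsort_step p M w) = (card K - p) + sor w"
      using sor_unsort_step[of w M p] lw dw sw insert.hyps p by auto
    moreover have "list_all2 (\<ge>) ls (unsort_step p M w) \<longleftrightarrow> M \<le> ls ! p \<and> list_all2 (\<ge>) ls' w"
      using list_all2_unsort_step[of ls' x w p M] insert.prems insert.hyps ls l' lw sw p
      by (auto intro: less_imp_le)
    ultimately show "(if list_all2 (\<ge>) ls (unsort_step p M w) then q ^ sor (unsort_step p M w) else 0)
      = (if M \<le> ls ! p then q ^ (card K - p) * ?g w else 0)"
      by (simp add: power_add)
  qed
  also have "\<dots> = (\<Sum>p\<le>card K. if M \<le> ls ! p then q ^ (card K - p) else 0) * (\<Sum>w\<in>permutations_of_set K. ?g w)"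
    unfolding sum_product by (subst sum.swap) (intro sum.cong refl, simp)
  also have "(\<Sum>p\<le>card K. if M \<le> ls ! p then q ^ (card K - p) else 0) = 
     (\<Sum>p\<in>{p\<in>{..card K}. M \<le> ls ! p}. q ^ (card K - p))"
    by (rule sum.inter_filter[symmetric]) simp
  also have "{p\<in>{..card K}. M \<le> ls ! p} = {?c..card K}"
    using nth_less_iff_less_card[OF insert.prems(1,2)] ls l'
    by (auto simp: less_Suc_eq_le simp flip: not_less)
  also have "(\<Sum>p\<in>{?c..card K}. q ^ (card K - p)) = (\<Sum>i<Suc (card K) - ?c. q ^ i)"
    by (rule sum.reindex_bij_witness[where i = "\<lambda>i. card K - i" and j = "\<lambda>p. card K - p"]) auto
  also have "Suc (card K) - ?c = card {l \<in> set ls. M \<le> l}"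
  proof -
    have "Suc (card K) = card (set ls)" using insert.prems l' ls by (simp add: distinct_card)
    also have "set ls = {l \<in> set ls. M \<le> l} \<union> {l \<in> set ls. l < M}" by auto
    also have "card \<dots> = card {l \<in> set ls. M \<le> l} + ?c" by (rule card_Un_disjoint) auto
    finally show ?thesis by simp
  qed
  also have "(\<Sum>i<card {l \<in> set ls. M \<le> l}. q ^ i) = 
     qnum q (int (card {l \<in> set ls. M \<le> l}) - int (card {k' \<in> Set.insert M K. M < k'}))" (is "_ = ?first")
  proof -
    have "{k' \<in> Set.insert M K. M < k'} = {}" using insert.hyps by auto
    then have "card {k' \<in> Set.insert M K. M < k'} = 0" by (metis card.empty)
    then show ?thesis by (simp add: qnum_def)
  qed
  also have "(\<Sum>w\<in>permutations_of_set K. ?g w) =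
     (\<Prod>k\<in>K. qnum q (int (card {l \<in> set ls'. k \<le> l}) - int (card {k' \<in> K. k < k'})))"
    by (rule insert.IH) (use insert.prems ls l' in \<open>auto simp: sorted_append\<close>)
  also have "?first * \<dots> = ?first * 
    (\<Prod>k\<in>K. qnum q (int (card {l \<in> set ls. k \<le> l}) - int (card {k' \<in> Set.insert M K. k < k'})))"
  proof (cases "M \<le> x")
    case False
    then have "{l \<in> set ls. M \<le> l} = {}" using insert.prems(1) ls by (auto simp: sorted_append)
    then have "card {l \<in> set ls. M \<le> l} = 0" by (metis card.empty)
    then have "?first = 0" by (simp only:) (rule qnum_nonpos, simp)
    then show ?thesis by (simp only: mult_zero_left)
  next
    case True
    have "card {l \<in> set ls. k \<le> l} = Suc (card {l \<in> set ls'. k \<le> l})" 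
      "card {k' \<in> Set.insert M K. k < k'} = Suc (card {k' \<in> K. k < k'})" if k: "k \<in> K" for k
    proof -
      have kM: "k < M" using k insert.hyps by auto
      have "{l \<in> set ls. k \<le> l} = Set.insert x {l \<in> set ls'. k \<le> l}"
        "{k' \<in> Set.insert M K. k < k'} = Set.insert M {k' \<in> K. k < k'}" using kM True ls by auto
      then show "card {l \<in> set ls. k \<le> l} = Suc (card {l \<in> set ls'. k \<le> l})" 
      "card {k' \<in> Set.insert M K. k < k'} = Suc (card {k' \<in> K. k < k'})" 
        using x M insert.hyps by auto
    qed
    then show ?thesis by simp
  qed
  finally show ?case using insert.hyps M by simp
qed

section \<open>Excedances and the sorting-Denert statistic\<close>

text \<open>
  Counting from above, as \<open>sum_sor_below_bounds\<close> does, is turned into counting from below, as the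
  height does. The shift by one arises because the positions range over \<open>{k..n}\<close> and the larger
  letters over \<open>{k+1..n}\<close>.
\<close>

lemma height_complement:
  assumes I: "I \<subseteq> {1..n}" and J: "J \<subseteq> {1..n}" and c: "card I = card J" and k: "k \<in> {1..n} - J"
  shows "int (card {l \<in> {1..n} - I. k \<le> l}) - int (card {k' \<in> {1..n} - J. k < k'}) = height I J k + 1"
proof -
  have fin: "finite I" "finite J" using I J by (auto intro: finite_subset)
  have "card {k..n} = card {l \<in> {1..n} - I. k \<le> l} + card {i \<in> I. k \<le> i}"
  proof -
    have "{k..n} = {l \<in> {1..n} - I. k \<le> l} \<union> {i \<in> I. k \<le> i}" using I k by auto
    then show ?thesis using fin by (simp only:) (rule card_Un_disjoint, auto)
  qed
  moreover have "card {Suc k..n} = card {k' \<in> {1..n} - J. k < k'} + card {j \<in> J. k < j}"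
  proof -
    have "{Suc k..n} = {k' \<in> {1..n} - J. k < k'} \<union> {j \<in> J. k < j}" using J k by auto
    then show ?thesis using fin by (simp only:) (rule card_Un_disjoint, auto)
  qed
  moreover have "card I = card {i \<in> I. i < k} + card {i \<in> I. k \<le> i}"
  proof -
    have "card I = card ({i \<in> I. i < k} \<union> {i \<in> I. k \<le> i})"
      by (rule arg_cong[of _ _ card]) auto
    also have "\<dots> = card {i \<in> I. i < k} + card {i \<in> I. k \<le> i}"
      by (rule card_Un_disjoint) (use fin in auto)
    finally show ?thesis .
  qed
  moreover have "card J = card {j \<in> J. j < k} + card {j \<in> J. k < j}"
  proof -
    have "card J = card ({j \<in> J. j < k} \<union> {j \<in> J. k < j})"
      by (rule arg_cong[of _ _ card]) (use k in \<open>auto simp: not_less_iff_gr_or_eq\<close>)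
    also have "\<dots> = card {j \<in> J. j < k} + card {j \<in> J. k < j}"
      by (rule card_Un_disjoint) (use fin in auto)
    finally show ?thesis .
  qed
  moreover have "k \<le> n" using k by simp
  ultimately show ?thesis using c by (simp add: height_def)
qed

definition positions :: "nat \<Rightarrow> nat set \<Rightarrow> nat list" where
  "positions n A = filter (\<lambda>i. i \<in> A) [1..<n + 1]"

lemma positions_props:
  assumes "A \<subseteq> {1..n}"
  shows "set (positions n A) = A" "sorted (positions n A)" "distinct (positions n A)"
    "length (positions n A) = card A"
proof -
  show s: "set (positions n A) = A" using assms by (auto simp: positions_def)
  show "sorted (positions n A)" unfolding positions_def by (rule sorted_wrt_filter) (simp del: upt_Suc)
  show d: "distinct (positions n A)" by (simp add: positions_def del: upt_Suc)
  show "length (positions n A) = card A" using distinct_card[OF d] s by simp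
qed

lemma EXCL_eq: "EXCL w = map (entry w) (positions (length w) (Exc w))"
  by (simp add: EXCL_def positions_def)

lemma NEXCL_eq: "NEXCL w = map (entry w) (positions (length w) ({1..length w} - Exc w))"
  unfolding NEXCL_def positions_def by (intro arg_cong[of _ _ "map (entry w)"] filter_cong) auto

lemma ex_map_eq:
  assumes "distinct xs" "length xs = length ys"
  shows "\<exists>f. map f xs = ys"
  using assms(2,1)
proof (induction xs ys rule: list_induct2)
  case Nil
  then show ?case by simp
next
  case (Cons x xs y ys)
  then obtain f where "map f xs = ys" by auto
  then have "map (f(x := y)) (x # xs) = y # ys" using Cons.prems by auto
  then show ?case by (rule exI[of _ "f(x := y)"])
qed

lemma bij_betw_entry:
  assumes "w \<in> perms n"
  shows "bij_betw (entry w) {1..n} {1..n}"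
proof -
  have w: "length w = n" "distinct w" "set w = {1..n}"
    using assms by (auto dest: permutations_of_setD length_finite_permutations_of_set)
  have e: "entry w = (\<lambda>i. w ! i) \<circ> (\<lambda>i. i - 1)" by (auto simp: entry_def)
  have "bij_betw (\<lambda>i. i - 1) {1..n} {..<n}"
    by (rule bij_betw_byWitness[where f' = Suc]) auto
  moreover have "bij_betw (\<lambda>i. w ! i) {..<n} {1..n}" using bij_betw_nth[of w "{..<n}" "{1..n}"] w by simp
  ultimately show ?thesis unfolding e by (rule bij_betw_trans)
qed

lemma Exc_subset: "w \<in> perms n \<Longrightarrow> Exc w \<subseteq> {1..n}"
  by (auto simp: Exc_def dest: length_finite_permutations_of_set)

text \<open>
  Once the excedance positions and letters are given, the two subsequences determine the permutation
  and can be chosen independently; the bounds on them say precisely that the excedances are at \<open>I\<close>.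
\<close>

lemma bij_betw_EXCL_NEXCL:
  assumes I: "I \<subseteq> {1..n}" and J: "J \<subseteq> {1..n}"
  defines "L \<equiv> {1..n} - I" and "K \<equiv> {1..n} - J"
  shows "bij_betw (\<lambda>w. (EXCL w, NEXCL w)) {w \<in> perms n. Exc w = I \<and> set (EXCL w) = J}
    ({u \<in> permutations_of_set J. list_all2 (<) (positions n I) u} \<times>
     {v \<in> permutations_of_set K. list_all2 (\<ge>) (positions n L) v})"
proof (rule bij_betw_imageI)
  let ?S = "{w \<in> perms n. Exc w = I \<and> set (EXCL w) = J}"
  have LI: "L \<subseteq> {1..n}" and IL: "I \<union> L = {1..n}" "I \<inter> L = {}" using I by (auto simp: L_def)
  note PI = positions_props[OF I] and PL = positions_props[OF LI]
  have S: "length w = n" "EXCL w = map (entry w) (positions n I)" "NEXCL w = map (entry w) (positions n L)"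
    if "w \<in> ?S" for w
    using that by (auto simp: EXCL_eq NEXCL_eq L_def dest: length_finite_permutations_of_set)
  show "inj_on (\<lambda>w. (EXCL w, NEXCL w)) ?S"
  proof (rule inj_onI)
    fix w w' assume w: "w \<in> ?S" "w' \<in> ?S" and eq: "(EXCL w, NEXCL w) = (EXCL w', NEXCL w')"
    have "entry w i = entry w' i" if "i \<in> {1..n}" for i
      using eq S[OF w(1)] S[OF w(2)] PI(1) PL(1) IL that by auto
    then have "entry w (Suc i) = entry w' (Suc i)" if "i < n" for i using that by auto
    then show "w = w'" using S[OF w(1)] S[OF w(2)] by (simp add: entry_def list_eq_iff_nth_eq)
  qed
  show "(\<lambda>w. (EXCL w, NEXCL w)) ` ?S = 
    {u \<in> permutations_of_set J. list_all2 (<) (positions n I) u} \<times>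
     {v \<in> permutations_of_set K. list_all2 (\<ge>) (positions n L) v}" (is "_ = ?U \<times> ?V")
  proof (intro equalityI subsetI)
    fix z assume "z \<in> (\<lambda>w. (EXCL w, NEXCL w)) ` ?S"
    then obtain w where w: "w \<in> ?S" and z: "z = (EXCL w, NEXCL w)" by auto
    have wp: "w \<in> perms n" and E: "Exc w = I" and sJ: "set (EXCL w) = J" using w by auto
    have b: "entry w ` {1..n} = {1..n}" "inj_on (entry w) {1..n}"
      using bij_betw_entry[OF wp] by (auto simp: bij_betw_def)
    have "set (NEXCL w) = entry w ` {1..n} - entry w ` I"
      using S[OF w] PL(1) b(2) I unfolding L_def by (simp add: inj_on_image_set_diff[OF b(2)])
    also have "\<dots> = K" using b(1) sJ S[OF w] PI(1) by (simp add: K_def)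
    finally have "set (NEXCL w) = K" .
    moreover have "distinct (EXCL w)" "distinct (NEXCL w)"
      using S(2,3)[OF w] PI(1,3) PL(1,3) inj_on_subset[OF b(2) I] inj_on_subset[OF b(2) LI]
      by (simp_all add: distinct_map)
    moreover have "list_all2 (<) (positions n I) (EXCL w)" 
      using PI(1) E S[OF w] by (auto simp: list_all2_map2 list_all2_same Exc_def)
    moreover have "list_all2 (\<ge>) (positions n L) (NEXCL w)" 
      using PL(1) E S[OF w] by (auto simp: list_all2_map2 list_all2_same Exc_def L_def)
    ultimately show "z \<in> ?U \<times> ?V" using z sJ by (auto intro: permutations_of_setI)
  next
    fix z assume "z \<in> ?U \<times> ?V"
    then obtain u v where z: "z = (u, v)" and u: "set u = J" "distinct u" "list_all2 (<) (positions n I) u"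
      and v: "set v = K" "distinct v" "list_all2 (\<ge>) (positions n L) v"
      by (auto dest: permutations_of_setD)
    obtain f where f: "map f (positions n I) = u" using ex_map_eq[OF PI(3)] u(3) by (metis list_all2_lengthD)
    obtain g where g: "map g (positions n L) = v" using ex_map_eq[OF PL(3)] v(3) by (metis list_all2_lengthD)
    define h where "h i = (if i \<in> I then f i else g i)" for i
    define w where "w = map h [1..<n + 1]"
    have hu: "map h (positions n I) = u" and hv: "map h (positions n L) = v"
      using PI(1) PL(1) IL by (auto simp: h_def simp flip: f g)
    have l: "length w = n" by (simp add: w_def)
    have e: "entry w i = h i" if "i \<in> {1..n}" for i
    proof -
      have "i - 1 < n" using that by auto
      then show ?thesis using that by (simp add: entry_def w_def nth_upt del: upt_Suc)
    qed
    have "set w = h ` {1..n}" unfolding w_def by (auto simp del: upt_Suc)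
    also have "\<dots> = h ` I \<union> h ` L" using IL by auto
    also have "\<dots> = J \<union> K" using hu hv PI(1) PL(1) u(1) v(1) by (metis set_map)
    finally have sw: "set w = {1..n}" using J by (auto simp: K_def)
    then have "distinct w" by (intro card_distinct) (simp add: l)
    with sw have wp: "w \<in> perms n" by (intro permutations_of_setI)
    have gt: "i < h i" if "i \<in> I" for i
      using u(3) that PI(1) unfolding hu[symmetric] by (auto simp: list_all2_map2 list_all2_same)
    have le: "h i \<le> i" if "i \<in> L" for i
      using v(3) that PL(1) unfolding hv[symmetric] by (auto simp: list_all2_map2 list_all2_same)
    have "i \<in> Exc w \<longleftrightarrow> i \<in> I" if "i \<in> {1..n}" for i
      using gt[of i] le[of i] e[OF that] that IL l by (auto simp: Exc_def)
    then have E: "Exc w = I" using I Exc_subset[OF wp] by blast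
    have "EXCL w = u" using E l e PI(1) I unfolding EXCL_eq hu[symmetric] by (auto)
    moreover have "NEXCL w = v" using E l e PL(1) LI unfolding NEXCL_eq hv[symmetric] by (auto simp: L_def)
    ultimately have "w \<in> ?S" "z = (EXCL w, NEXCL w)" using wp E u z by auto
    then show "z \<in> (\<lambda>w. (EXCL w, NEXCL w)) ` ?S" by blast
  qed
qed

text \<open>
  If \<open>I\<close> and \<open>J\<close> differ in size, no permutation has them as its excedance positions and letters.
  Otherwise \<open>q\<^bsup>sden\<^esup>\<close> is multiplicative over the independent choices of the two subsequences.
\<close>

lemma sum_sden_eq_weight:
  fixes q :: "'a::comm_semiring_1"
  assumes I: "I \<subseteq> {1..n}" and J: "J \<subseteq> {1..n}"
  shows "(\<Sum>w\<in>{w \<in> perms n. Exc w = I \<and> set (EXCL w) = J}. q ^ sden w)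
    = (if card I = card J then weight q n I J else 0)"
proof -
  let ?S = "{w \<in> perms n. Exc w = I \<and> set (EXCL w) = J}"
  let ?U = "{u \<in> permutations_of_set J. list_all2 (<) (positions n I) u}"
  let ?V = "{v \<in> permutations_of_set ({1..n} - J). list_all2 (\<ge>) (positions n ({1..n} - I)) v}"
  have fin: "finite J" using J by (rule finite_subset) simp
  have LI: "{1..n} - I \<subseteq> {1..n}" by auto
  note PI = positions_props[OF I] and PL = positions_props[OF LI]
  have "(\<Sum>w\<in>?S. q ^ sden w) = (\<Sum>w\<in>?S. (\<lambda>(u, v). q ^ \<Sum>I * (q ^ inversions u * q ^ sor v)) (EXCL w, NEXCL w))"
    by (intro sum.cong refl) (auto simp: sden_def power_add mult_ac)
  also have "\<dots> = (\<Sum>(u, v)\<in>?U \<times> ?V. q ^ \<Sum>I * (q ^ inversions u * q ^ sor v))"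
    by (rule sum.reindex_bij_betw[OF bij_betw_EXCL_NEXCL[OF I J]])
  also have "\<dots> = q ^ \<Sum>I * ((\<Sum>u\<in>?U. q ^ inversions u) * (\<Sum>v\<in>?V. q ^ sor v))"
    unfolding sum_product by (simp only: sum.cartesian_product[symmetric] sum_distrib_left)
  finally have main: "(\<Sum>w\<in>?S. q ^ sden w) = 
    q ^ \<Sum>I * ((\<Sum>u\<in>?U. q ^ inversions u) * (\<Sum>v\<in>?V. q ^ sor v))" .
  show ?thesis
  proof (cases "card I = card J")
    case False
    have "?U = {}" using PI(4) False
      by (auto dest!: list_all2_lengthD length_finite_permutations_of_set)
    then have "(\<Sum>u\<in>?U. q ^ inversions u) = 0" by (simp only: sum.empty)
    then show ?thesis unfolding main using False by (simp only: if_False mult_zero_left mult_zero_right)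
  next
    case True
    have cK: "card ({1..n} - I) = card ({1..n} - J)"
      using True I J by (simp add: card_Diff_subset finite_subset)
    have "(\<Sum>u\<in>?U. q ^ inversions u) = (\<Prod>j\<in>J. qnum q (height I J j))"
      using sum_inversions_above_bounds[OF fin PI(2,3), of q] PI(1,4) True
      by (simp add: sum.inter_filter)
    moreover have "(\<Sum>v\<in>?V. q ^ sor v) = (\<Prod>k\<in>{1..n} - J. qnum q (height I J k + 1))"
    proof -
      have "(\<Sum>v\<in>?V. q ^ sor v) = (\<Prod>k\<in>{1..n} - J.
         qnum q (int (card {l \<in> {1..n} - I. k \<le> l}) - int (card {k' \<in> {1..n} - J. k < k'})))"
        using sum_sor_below_bounds[OF _ PL(2,3), of "{1..n} - J" q] PL(1,4) cK
        by (simp add: sum.inter_filter)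
      also have "\<dots> = (\<Prod>k\<in>{1..n} - J. qnum q (height I J k + 1))"
        by (intro prod.cong refl arg_cong[of _ _ "qnum q"] height_complement[OF I J True])
      finally show ?thesis .
    qed
    ultimately show ?thesis using main True by (simp add: weight_def mult.assoc)
  qed
qed

definition exc_sden_gf :: "'a::comm_semiring_1 \<Rightarrow> nat \<Rightarrow> int \<Rightarrow> 'a" where
  "exc_sden_gf q n k = (\<Sum>w\<in>perms n. if int (exc w) = k then q ^ sden w else 0)"

lemma exc_sden_gf_eq_walk_gf: "exc_sden_gf q n k = walk_gf q n k 0"
proof -
  let ?g = "\<lambda>w. if int (exc w) = k then q ^ sden w else 0"
  let ?key = "\<lambda>w. (Exc w, set (EXCL w))"
  let ?T = "Pow {1..n} \<times> Pow {1..n}"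
  have key: "?key w \<in> ?T" if w: "w \<in> perms n" for w
  proof -
    have l: "length w = n" "set w = {1..n}"
      using w by (auto dest: permutations_of_setD length_finite_permutations_of_set)
    have "set (EXCL w) \<subseteq> entry w ` {1..n}" 
      using positions_props(1)[OF Exc_subset[OF w]] Exc_subset[OF w] l by (auto simp: EXCL_eq)
    then show ?thesis using Exc_subset[OF w] bij_betw_entry[OF w] by (auto simp: bij_betw_def)
  qed
  have "exc_sden_gf q n k = (\<Sum>y\<in>?T. \<Sum>w\<in>{w \<in> perms n. ?key w = y}. ?g w)"
    unfolding exc_sden_gf_def by (rule sum.group[symmetric]) (use key in auto)
  also have "\<dots> = (\<Sum>(I, J)\<in>?T. if int (card I) = k \<and> int (card I) - int (card J) = 0
      then weight q n I J else 0)"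
  proof (intro sum.cong refl)
    fix y assume "y \<in> ?T"
    then obtain I J where y: "y = (I, J)" and I: "I \<subseteq> {1..n}" and J: "J \<subseteq> {1..n}" by auto
    have "(\<Sum>w\<in>{w \<in> perms n. ?key w = y}. ?g w) = 
       (if int (card I) = k then \<Sum>w\<in>{w \<in> perms n. Exc w = I \<and> set (EXCL w) = J}. q ^ sden w else 0)"
      unfolding y by (auto simp: exc_def intro!: sum.cong)
    then show "(\<Sum>w\<in>{w \<in> perms n. ?key w = y}. ?g w) = 
      (case y of (I, J) \<Rightarrow> if int (card I) = k \<and> int (card I) - int (card J) = 0 then weight q n I J else 0)"
      unfolding sum_sden_eq_weight[OF I J] y by simp
  qed
  also have "\<dots> = walk_gf q n k 0"
    by (simp add: walk_gf_def sum.cartesian_product)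
  finally show ?thesis .
qed

text \<open>
  For \<open>q\<close> the indeterminate of \<open>nat poly\<close>, the coefficients of a generating function are the
  cardinalities to be compared.
\<close>

lemma card_eq_coeff:
  assumes "finite S"
  shows "card {w \<in> S. int (f w) = a \<and> g w = b} =
    coeff (\<Sum>w\<in>S. if int (f w) = a then monom (1::nat) 1 ^ g w else 0) b"
proof -
  have "coeff (\<Sum>w\<in>S. if int (f w) = a then monom (1::nat) 1 ^ g w else 0) b
    = (\<Sum>w\<in>S. if int (f w) = a \<and> g w = b then 1 else 0)"
    unfolding coeff_sum by (intro sum.cong refl) (auto simp: monom_power)
  then show ?thesis using assms by (simp add: sum.inter_filter[symmetric])
qed

theorem theorem1p1:
  fixes n :: nat and a b :: int
  assumes "n \<ge> 1"
  shows "card {\<sigma> \<in> perms n. int (exc \<sigma>) = a \<and> int (sden \<sigma>) = b}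
       = card {\<sigma> \<in> perms n. int (des \<sigma>) = a \<and> int (maj \<sigma>) = b}"
proof (cases "b < 0")
  case True
  then have "{\<sigma> \<in> perms n. int (exc \<sigma>) = a \<and> int (sden \<sigma>) = b} = {}"
    "{\<sigma> \<in> perms n. int (des \<sigma>) = a \<and> int (maj \<sigma>) = b} = {}" by auto
  then show ?thesis by (simp only:)
next
  case False
  then obtain c where b: "b = int c" by (metis nonneg_int_cases not_less)
  have "exc_sden_gf (monom (1::nat) 1) n a = des_maj_gf (monom 1 1) n a"
    by (simp add: exc_sden_gf_eq_walk_gf des_maj_gf_eq_walk_gf)
  then show ?thesis
    by (simp only: b of_nat_eq_iff card_eq_coeff[OF finite_permutations_of_set] exc_sden_gf_def des_maj_gf_def)
qed

end
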